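(* Let $\mathcal X$ be a Polish space, $\Omega=D([0,1],\mathcal X)$, and let $C:\Omega\to[0,\infty]$ be lower semicontinuous. For each integer $k\ge1$ let $(R^{k,x})_{x\in\mathcal X}$ be a measurable kernel of probability measures on $\Omega$ with $R^{k,x}(\{X_0=x\})=1$ for every $x$. Assume that for each $x\in\mathcal X$ the sequence $(R^{k,x})_{k\ge1}$ satisfies the large deviation principle in $\Omega$ with scale $k$ and the coercive rate function $C^x=C+\iota_{\{X_0=x\}}:\Omega\to[0,\infty]$. Then for any $\mu_0\in\mathrm P(\mathcal X)$, $$\Gamma\text{-}\lim_{k\to\infty}\mathcal C^{k,\mu_0}=\mathcal C^{\mu_0}\quad\text{in }\mathrm P(\Omega),$$ where, for $P\in\mathrm P(\Omega)$, $$\mathcal C^{k,\mu_0}(P):=\tfrac1kH(P|R^{k,\mu_0})+\iota_{\{P_0=\mu_0\}},\qquad \mathcal C^{\mu_0}(P):=\int_\Omega C\,dP+\iota_{\{P_0=\mu_0\}}.$$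
   Context: $\Omega=D([0,1],\mathcal X)$ is the set of càdlàg $\mathcal X$-valued paths on $[0,1]$ with the Skorokhod metric (a Polish space); $X_t(\omega)=\omega_t$. $\mathrm P(E)$ is the set of Borel probability measures on $E$ with the narrow topology (weakest making $\mu\mapsto\int f\,d\mu$ continuous for all bounded continuous $f$). $P_0:=(X_0)_\#P$. $R^{k,\mu_0}:=\int_{\mathcal X}R^{k,x}\,\mu_0(dx)$. $\iota_A$ (or $\iota_{\{x\in A\}}$) is $0$ on $A$ and $+\infty$ off $A$. $H(P|R)=\int\log(dP/dR)\,dP\in[0,\infty]$ if $P\ll R$, $\infty$ otherwise. Coercive: all sublevel sets $\{f\le a\}$, $a\in\mathbb R$, are compact. A sequence $(\gamma_k)_{k\ge1}$ of Borel probability measures on a Polish space $E$ satisfies the large deviation principle with scale $k$ and rate function $I:E\to[0,\infty]$ (lower semicontinuous) if for each Borel $A\subset E$, $-\inf_{\mathrm{int} A}I\le\liminf_k\frac1k\log\gamma_k(A)\le\limsup_k\frac1k\log\gamma_k(A)\le-\inf_{\mathrm{cl} A}I$. $\Gamma\text{-}\lim_kf_k=f$ on a topological space $E$ means that for every $x\in E$, $\sup_V\liminf_k\inf_Vf_k=\sup_V\limsup_k\inf_Vf_k=f(x)$, where $V$ ranges over the neighborhoods of $x$. *)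

theory Defs
  imports "HOL-Probability.Probability"
begin


definition cadlag_on_unit :: "(real \<Rightarrow> 'a::topological_space) \<Rightarrow> bool" where
  "cadlag_on_unit f \<longleftrightarrow>
     (\<forall>t\<in>{0..<1}. (f \<longlongrightarrow> f t) (at_right t)) \<and> (\<forall>t\<in>{0<..1}. \<exists>l. (f \<longlongrightarrow> l) (at_left t))"

text \<open>Paths are functions on \<open>{0..1}\<close>; \<^const>\<open>extensional\<close> only fixes the irrelevant
  values outside \<open>{0..1}\<close>.\<close>

typedef (overloaded) ('a::topological_space) cadlag =
  "{f :: real \<Rightarrow> 'a. f \<in> extensional {0..1} \<and> cadlag_on_unit f}"
  morphisms path Abs_cadlag
proof
  show "restrict (\<lambda>_. undefined) {0..1} \<in> {f :: real \<Rightarrow> 'a. f \<in> extensional {0..1} \<and> cadlag_on_unit f}"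
    unfolding cadlag_on_unit_def
  proof (intro CollectI conjI ballI)
    fix t :: real
    assume t: "t \<in> {0..<1}"
    have "\<forall>\<^sub>F u in at_right t. restrict (\<lambda>_. undefined :: 'a) {0..1} u = undefined"
      by (simp add: restrict_def)
    then show "(restrict (\<lambda>_. undefined :: 'a) {0..1} \<longlongrightarrow> restrict (\<lambda>_. undefined) {0..1} t) (at_right t)"
      by (simp add: restrict_def)
  next
    fix t :: real
    show "\<exists>l. (restrict (\<lambda>_. undefined :: 'a) {0..1} \<longlongrightarrow> l) (at_left t)"
      by (rule exI[of _ undefined]) (simp add: restrict_def)
  qed simp
qed

definition coord :: "real \<Rightarrow> 'a::topological_space cadlag \<Rightarrow> 'a" where
  "coord t \<omega> = path \<omega> t"

definition time_changes :: "(real \<Rightarrow> real) set" where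
  "time_changes = {l. strict_mono_on {0..1} l \<and> continuous_on {0..1} l \<and> l ` {0..1} = {0..1}}"

definition skorokhod_close :: "real \<Rightarrow> 'a::metric_space cadlag \<Rightarrow> 'a cadlag \<Rightarrow> bool" where
  "skorokhod_close e x y \<longleftrightarrow> 0 \<le> e \<and>
     (\<exists>l\<in>time_changes. \<forall>t\<in>{0..1}. \<bar>l t - t\<bar> \<le> e \<and> dist (coord t x) (coord (l t) y) \<le> e)"

lemma coord_right_limit:
  assumes "0 \<le> t" "t < 1"
  shows "((\<lambda>s. coord s x) \<longlongrightarrow> coord t x) (at_right t)"
  using path[of x] assms by (auto simp: cadlag_on_unit_def coord_def)

lemma coord_left_limit:
  assumes "0 < t" "t \<le> 1"
  shows "\<exists>l. ((\<lambda>s. coord s x) \<longlongrightarrow> l) (at_left t)"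
  using path[of x] assms by (auto simp: cadlag_on_unit_def coord_def)

lemma cadlag_eqI:
  assumes "\<And>t. t \<in> {0..1} \<Longrightarrow> coord t x = coord t y"
  shows "x = y"
proof -
  have "path x = path y"
    using path[of x] path[of y] assms
    by (intro extensionalityI[of _ "{0..1}"]) (auto simp: coord_def)
  then show ?thesis by (simp add: path_inject)
qed

lemma cadlag_bounded:
  fixes x :: "'a::metric_space cadlag"
  shows "\<exists>B. \<forall>t\<in>{0..1}. dist a (coord t x) \<le> B"
proof -
  have loc: "\<exists>B. \<forall>\<^sub>F u in nhds t. u \<in> {0..1} \<longrightarrow> dist a (coord u x) \<le> B" if t: "t \<in> {0..1}" for t
  proof -
    have bd: "\<forall>\<^sub>F u in F. dist a (coord u x) \<le> dist a l + 1"
      if "((\<lambda>s. coord s x) \<longlongrightarrow> l) F" for l F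
    proof -
      have "\<forall>\<^sub>F u in F. dist (coord u x) l < 1" using tendstoD[OF that, of 1] by simp
      then show ?thesis
      proof eventually_elim
        case (elim u)
        then show ?case using dist_triangle[of a "coord u x" l] by (simp add: dist_commute)
      qed
    qed
    obtain B1 where B1: "\<forall>\<^sub>F u in at_right t. u \<in> {0..1} \<longrightarrow> dist a (coord u x) \<le> B1"
    proof (cases "t < 1")
      case True
      then have "((\<lambda>s. coord s x) \<longlongrightarrow> coord t x) (at_right t)" using coord_right_limit[of t x] t by auto
      then have "\<forall>\<^sub>F u in at_right t. u \<in> {0..1} \<longrightarrow> dist a (coord u x) \<le> dist a (coord t x) + 1"
        by (rule eventually_mono[OF bd]) simp
      then show ?thesis by (rule that)
    next
      case False
      then have "\<forall>\<^sub>F u in at_right t. u \<notin> {0..1}"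
        using t by (auto simp: eventually_at_filter)
      then have "\<forall>\<^sub>F u in at_right t. u \<in> {0..1} \<longrightarrow> dist a (coord u x) \<le> 0"
        by (rule eventually_mono) blast
      then show ?thesis by (rule that)
    qed
    obtain B2 where B2: "\<forall>\<^sub>F u in at_left t. u \<in> {0..1} \<longrightarrow> dist a (coord u x) \<le> B2"
    proof (cases "t > 0")
      case True
      then obtain l where "((\<lambda>s. coord s x) \<longlongrightarrow> l) (at_left t)" using coord_left_limit[of t x] t by auto
      then have "\<forall>\<^sub>F u in at_left t. u \<in> {0..1} \<longrightarrow> dist a (coord u x) \<le> dist a l + 1"
        by (rule eventually_mono[OF bd]) simp
      then show ?thesis by (rule that)
    next
      case False
      then have "\<forall>\<^sub>F u in at_left t. u \<notin> {0..1}"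
        using t by (auto simp: eventually_at_filter)
      then have "\<forall>\<^sub>F u in at_left t. u \<in> {0..1} \<longrightarrow> dist a (coord u x) \<le> 0"
        by (rule eventually_mono) blast
      then show ?thesis by (rule that)
    qed
    define B where "B = Max {B1, B2, dist a (coord t x)}"
    have le: "B1 \<le> B" "B2 \<le> B" "dist a (coord t x) \<le> B" by (auto simp: B_def)
    have "\<forall>\<^sub>F u in at t. u \<in> {0..1} \<longrightarrow> dist a (coord u x) \<le> B"
      unfolding eventually_at_split
    proof
      show "\<forall>\<^sub>F u in at_left t. u \<in> {0..1} \<longrightarrow> dist a (coord u x) \<le> B"
        using B2 by (rule eventually_mono) (use le in auto)
      show "\<forall>\<^sub>F u in at_right t. u \<in> {0..1} \<longrightarrow> dist a (coord u x) \<le> B"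
        using B1 by (rule eventually_mono) (use le in auto)
    qed
    then have "\<forall>\<^sub>F u in nhds t. u \<noteq> t \<longrightarrow> u \<in> {0..1} \<longrightarrow> dist a (coord u x) \<le> B"
      by (simp add: eventually_at_filter)
    then have "\<forall>\<^sub>F u in nhds t. u \<in> {0..1} \<longrightarrow> dist a (coord u x) \<le> B"
      by (rule eventually_mono) (use le in auto)
    then show ?thesis by blast
  qed
  then have "\<forall>t\<in>{0..1}. \<exists>B S. open S \<and> t \<in> S \<and> (\<forall>u\<in>S. u \<in> {0..1} \<longrightarrow> dist a (coord u x) \<le> B)"
    unfolding eventually_nhds by blast
  then obtain B S where BS: "\<And>t. t \<in> {0..1} \<Longrightarrow> open (S t)" "\<And>t. t \<in> {0..1} \<Longrightarrow> t \<in> S t"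
      "\<And>t u. t \<in> {0..1} \<Longrightarrow> u \<in> S t \<Longrightarrow> u \<in> {0..1} \<Longrightarrow> dist a (coord u x) \<le> B t"
    by metis
  obtain C where C: "C \<subseteq> {0..1}" "finite C" "{0..1} \<subseteq> (\<Union>c\<in>C. S c)"
    by (rule compactE_image[OF compact_Icc, of "{0..1}" S "0::real" 1]) (use BS in auto)
  have "dist a (coord t x) \<le> (\<Sum>c\<in>C. \<bar>B c\<bar>)" if t: "t \<in> {0..1}" for t
  proof -
    obtain c where c: "c \<in> C" "t \<in> S c" using C t by blast
    then have "dist a (coord t x) \<le> B c" using BS(3)[of c t] C t by blast
    also have "\<dots> \<le> \<bar>B c\<bar>" by simp
    also have "\<dots> \<le> (\<Sum>c\<in>C. \<bar>B c\<bar>)" using c C by (intro member_le_sum) auto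
    finally show ?thesis .
  qed
  then show ?thesis by blast
qed

lemma id_time_changes: "(\<lambda>t. t) \<in> time_changes"
  by (auto simp: time_changes_def strict_mono_on_def)

lemma time_changes_mem: "l \<in> time_changes \<Longrightarrow> t \<in> {0..1} \<Longrightarrow> l t \<in> {0..1}"
  by (auto simp: time_changes_def)

lemma time_changes_ends:
  assumes l: "l \<in> time_changes"
  shows "l 0 = 0" "l 1 = 1"
proof -
  have mono: "l s \<le> l t" if "s \<in> {0..1}" "t \<in> {0..1}" "s \<le> t" for s t
    using l that unfolding time_changes_def by (auto simp: strict_mono_on_def le_less)
  have im: "l ` {0..1} = {0..1}" using l by (simp add: time_changes_def)
  have "0 \<in> l ` {0..1}" unfolding im by simp
  then obtain s where s: "s \<in> {0..1}" "l s = 0" by auto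
  have "1 \<in> l ` {0..1}" unfolding im by simp
  then obtain u where u: "u \<in> {0..1}" "l u = 1" by auto
  show "l 0 = 0" using mono[of 0 s] s time_changes_mem[OF l, of 0] by auto
  show "l 1 = 1" using mono[of u 1] u time_changes_mem[OF l, of 1] by auto
qed

lemma comp_time_changes:
  assumes l: "l \<in> time_changes" and m: "m \<in> time_changes"
  shows "(\<lambda>t. m (l t)) \<in> time_changes"
proof -
  have 1: "strict_mono_on {0..1} (\<lambda>t. m (l t))"
  proof (rule strict_mono_onI)
    fix r s :: real assume rs: "r \<in> {0..1}" "s \<in> {0..1}" "r < s"
    then have "l r < l s" using l by (auto simp: time_changes_def strict_mono_on_def)
    then show "m (l r) < m (l s)"
      using m time_changes_mem[OF l rs(1)] time_changes_mem[OF l rs(2)]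
      by (auto simp: time_changes_def strict_mono_on_def)
  qed
  have 2: "continuous_on {0..1} (\<lambda>t. m (l t))"
  proof (rule continuous_on_compose2[where g = m and f = l and t = "{0..1}"])
    show "continuous_on {0..1} m" "continuous_on {0..1} l" "l ` {0..1} \<subseteq> {0..1}"
      using l m by (simp_all only: time_changes_def mem_Collect_eq subset_refl)
  qed
  have 3: "(\<lambda>t. m (l t)) ` {0..1} = {0..1}"
  proof -
    have "(\<lambda>t. m (l t)) ` {0..1} = m ` (l ` {0..1})" by (rule image_image[symmetric])
    also have "\<dots> = {0..1}" using l m by (simp add: time_changes_def)
    finally show ?thesis .
  qed
  show ?thesis using 1 2 3 by (simp add: time_changes_def)
qed

lemma inv_time_changes:
  assumes l: "l \<in> time_changes"
  shows "inv_into {0..1} l \<in> time_changes"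
proof -
  have sm: "strict_mono_on {0..1} l" and im: "l ` {0..1} = {0..1}" and co: "continuous_on {0..1} l"
    using l by (auto simp: time_changes_def)
  have inj: "inj_on l {0..1}" using sm by (rule strict_mono_on_imp_inj_on)
  have 1: "strict_mono_on {0..1} (inv_into {0..1} l)"
  proof (rule strict_mono_onI)
    fix r s :: real assume rs: "r \<in> {0..1}" "s \<in> {0..1}" "r < s"
    let ?r = "inv_into {0..1} l r" and ?s = "inv_into {0..1} l s"
    have m: "?r \<in> {0..1}" "?s \<in> {0..1}" "l ?r = r" "l ?s = s"
      using rs im inv_into_into[of r l "{0..1}"] inv_into_into[of s l "{0..1}"]
        f_inv_into_f[of r l "{0..1}"] f_inv_into_f[of s l "{0..1}"] by auto
    show "?r < ?s"
    proof (rule ccontr)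
      assume "\<not> ?r < ?s"
      then consider "?s < ?r" | "?s = ?r" by linarith
      then show False
      proof cases
        case 1
        then have "l ?s < l ?r" by (rule strict_mono_onD[OF sm m(2) m(1)])
        then show False using m rs by simp
      next
        case 2
        then show False using m rs by simp
      qed
    qed
  qed
  have 2: "continuous_on {0..1} (inv_into {0..1} l)"
    using continuous_on_inv[OF co compact_Icc, of "inv_into {0..1} l"] inj im by simp
  have 3: "inv_into {0..1} l ` {0..1} = {0..1}"
    using inv_into_image_cancel[OF inj subset_refl] im by simp
  show ?thesis using 1 2 3 by (simp add: time_changes_def)
qed

lemma skorokhod_close_exists: "\<exists>e. skorokhod_close e x y"
proof -
  obtain a where "a = coord 0 x" by simp
  obtain B where B: "\<forall>t\<in>{0..1}. dist a (coord t x) \<le> B" using cadlag_bounded by blast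
  obtain B' where B': "\<forall>t\<in>{0..1}. dist a (coord t y) \<le> B'" using cadlag_bounded by blast
  have d: "dist (coord t x) (coord t y) \<le> \<bar>B\<bar> + \<bar>B'\<bar>" if "t \<in> {0..1}" for t
    using B[rule_format, OF that] B'[rule_format, OF that] dist_triangle3[of "coord t x" "coord t y" a]
    by linarith
  have "skorokhod_close (\<bar>B\<bar> + \<bar>B'\<bar>) x y"
    unfolding skorokhod_close_def using d by (auto intro!: bexI[OF _ id_time_changes])
  then show ?thesis by blast
qed

lemma skorokhod_close_refl: "skorokhod_close 0 x x"
  unfolding skorokhod_close_def by (auto intro!: bexI[OF _ id_time_changes])

lemma skorokhod_close_sym:
  assumes "skorokhod_close e x y"
  shows "skorokhod_close e y x"
proof -
  from assms obtain l where e: "0 \<le> e" and l: "l \<in> time_changes"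
    and c: "\<And>t. t \<in> {0..1} \<Longrightarrow> \<bar>l t - t\<bar> \<le> e \<and> dist (coord t x) (coord (l t) y) \<le> e"
    unfolding skorokhod_close_def by auto
  have im: "l ` {0..1} = {0..1}" using l by (simp add: time_changes_def)
  let ?m = "inv_into {0..1} l"
  have "\<bar>?m t - t\<bar> \<le> e \<and> dist (coord t y) (coord (?m t) x) \<le> e" if t: "t \<in> {0..1}" for t
  proof -
    have m: "?m t \<in> {0..1}" "l (?m t) = t"
      using t im inv_into_into[of t l "{0..1}"] f_inv_into_f[of t l "{0..1}"] by auto
    show ?thesis using c[OF m(1)] m(2) by (simp add: dist_commute abs_minus_commute)
  qed
  then show ?thesis using e inv_time_changes[OF l] unfolding skorokhod_close_def by blast
qed

lemma skorokhod_close_trans: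
  assumes "skorokhod_close e x y" "skorokhod_close d y z"
  shows "skorokhod_close (e + d) x z"
proof -
  from assms(1) obtain l where e: "0 \<le> e" and l: "l \<in> time_changes"
    and c: "\<And>t. t \<in> {0..1} \<Longrightarrow> \<bar>l t - t\<bar> \<le> e \<and> dist (coord t x) (coord (l t) y) \<le> e"
    unfolding skorokhod_close_def by auto
  from assms(2) obtain m where d: "0 \<le> d" and m: "m \<in> time_changes"
    and c': "\<And>t. t \<in> {0..1} \<Longrightarrow> \<bar>m t - t\<bar> \<le> d \<and> dist (coord t y) (coord (m t) z) \<le> d"
    unfolding skorokhod_close_def by auto
  have "\<bar>m (l t) - t\<bar> \<le> e + d \<and> dist (coord t x) (coord (m (l t)) z) \<le> e + d" if t: "t \<in> {0..1}" for t
  proof -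
    note 1 = c[OF t] and 2 = c'[OF time_changes_mem[OF l t]]
    show ?thesis using 1 2 dist_triangle[of "coord t x" "coord (m (l t)) z" "coord (l t) y"] by linarith
  qed
  then show ?thesis using e d comp_time_changes[OF l m] unfolding skorokhod_close_def
    by (intro conjI bexI[of _ "\<lambda>t. m (l t)"]) auto
qed

lemma skorokhod_close_all_imp_eq:
  fixes x y :: "'a::metric_space cadlag"
  assumes cl: "\<And>e. e > 0 \<Longrightarrow> skorokhod_close e x y"
  shows "x = y"
proof (rule cadlag_eqI)
  fix t :: real assume t: "t \<in> {0..1}"
  have *: "dist (coord t x) (coord t y) \<le> 3 * e" if e: "e > 0" for e
  proof (cases "t = 1")
    case True
    from cl[OF e] obtain l where l: "l \<in> time_changes"
      and c: "\<And>t. t \<in> {0..1} \<Longrightarrow> \<bar>l t - t\<bar> \<le> e \<and> dist (coord t x) (coord (l t) y) \<le> e"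
      unfolding skorokhod_close_def by auto
    have "dist (coord 1 x) (coord 1 y) \<le> e" using c[of 1] time_changes_ends[OF l] by simp
    then show ?thesis using True e by simp
  next
    case False
    with t have t1: "0 \<le> t" "t < 1" by auto
    have "\<forall>\<^sub>F u in at_right t. dist (coord u x) (coord t x) < e \<and> dist (coord u y) (coord t y) < e"
      using tendstoD[OF coord_right_limit[OF t1] e] tendstoD[OF coord_right_limit[OF t1] e]
      by (rule eventually_conj)
    then obtain b where b: "b > t" "\<And>u. u > t \<Longrightarrow> u < b \<Longrightarrow>
        dist (coord u x) (coord t x) < e \<and> dist (coord u y) (coord t y) < e"
      unfolding eventually_at_right_field by auto
    define h where "h = (min b 1 - t) / 4"
    have "4 * h = min b 1 - t" by (simp add: h_def)
    then have h: "h > 0" "t + 4 * h \<le> b" "t + 4 * h \<le> 1" using b(1) t1 by linarith+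
    define s where "s = t + 2 * h"
    have s: "s \<in> {0..1}" "t < s" "s < b" using h t1 by (auto simp: s_def)
    have "min e h > 0" using e h by simp
    from cl[OF this] obtain l where l: "l \<in> time_changes"
      and c: "\<And>t. t \<in> {0..1} \<Longrightarrow> \<bar>l t - t\<bar> \<le> min e h \<and> dist (coord t x) (coord (l t) y) \<le> min e h"
      unfolding skorokhod_close_def by auto
    have ls: "\<bar>l s - s\<bar> \<le> h" "dist (coord s x) (coord (l s) y) \<le> e" using c[OF s(1)] by auto
    then have "t < l s" "l s < b" using h by (auto simp: s_def)
    from b(2)[OF this] b(2)[OF s(2,3)] ls(2)
      dist_triangle[of "coord t x" "coord t y" "coord s x"]
      dist_triangle[of "coord s x" "coord t y" "coord (l s) y"]
    show ?thesis by (simp add: dist_commute)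
  qed
  have "dist (coord t x) (coord t y) \<le> 0 + e" if "e > 0" for e
    using *[of "e / 3"] that by simp
  then have "dist (coord t x) (coord t y) \<le> 0" by (rule field_le_epsilon)
  then show "coord t x = coord t y" by simp
qed

text \<open>The Skorokhod \<open>J\<^sub>1\<close> metric.  When \<open>'a\<close> is Polish the topology it induces is Polish, although
  this particular metric is not complete.\<close>

instantiation cadlag :: (metric_space) metric_space
begin

definition dist_cadlag :: "'a cadlag \<Rightarrow> 'a cadlag \<Rightarrow> real" where
  "dist_cadlag x y = Inf {e. skorokhod_close e x y}"

definition uniformity_cadlag :: "('a cadlag \<times> 'a cadlag) filter" where
  "uniformity_cadlag = (INF e\<in>{0<..}. principal {(x, y). dist x y < e})"

definition open_cadlag :: "'a cadlag set \<Rightarrow> bool" where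
  "open_cadlag U \<longleftrightarrow> (\<forall>x\<in>U. \<forall>\<^sub>F (x', y) in uniformity. x' = x \<longrightarrow> y \<in> U)"

instance
proof
  have bdd: "bdd_below {e. skorokhod_close e x y}" for x y :: "'a cadlag"
    by (rule bdd_belowI[of _ 0]) (simp add: skorokhod_close_def)
  have ne: "{e. skorokhod_close e x y} \<noteq> {}" for x y :: "'a cadlag"
    using skorokhod_close_exists[of x y] by simp
  have nonneg: "0 \<le> dist x y" for x y :: "'a cadlag"
    unfolding dist_cadlag_def using ne by (intro cInf_greatest) (auto simp: skorokhod_close_def)
  have upper: "dist x y \<le> e" if "skorokhod_close e x y" for x y :: "'a cadlag" and e
    unfolding dist_cadlag_def using that by (intro cInf_lower bdd) simp
  have close: "\<exists>d<e. skorokhod_close d x y" if "dist x y < e" for x y :: "'a cadlag" and e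
    using that unfolding dist_cadlag_def cInf_less_iff[OF ne bdd] by auto
  have mono: "skorokhod_close e x y" if "skorokhod_close d x y" "d \<le> e" for x y :: "'a cadlag" and d e
    using that unfolding skorokhod_close_def by (meson order_trans)
  show "uniformity = (INF e\<in>{0<..}. principal {(x :: 'a cadlag, y). dist x y < e})"
    by (rule uniformity_cadlag_def)
  show "open U = (\<forall>x\<in>U. \<forall>\<^sub>F (x', y) in uniformity. x' = x \<longrightarrow> y \<in> U)" for U :: "'a cadlag set"
    by (rule open_cadlag_def)
  have sym: "dist x y = dist y x" for x y :: "'a cadlag"
    unfolding dist_cadlag_def using skorokhod_close_sym by metis
  show "(dist x y = 0) = (x = y)" for x y :: "'a cadlag"
  proof
    assume 0: "dist x y = 0"
    show "x = y"
    proof (rule skorokhod_close_all_imp_eq)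
      fix e :: real assume "e > 0"
      then show "skorokhod_close e x y" using close[of x y e] 0 mono by fastforce
    qed
  next
    assume "x = y"
    then show "dist x y = 0" using upper[OF skorokhod_close_refl[of x]] nonneg[of x x] by simp
  qed
  show "dist x y \<le> dist x z + dist y z" for x y z :: "'a cadlag"
  proof (rule field_le_epsilon)
    fix e :: real assume e: "e > 0"
    obtain d1 where d1: "d1 < dist x z + e / 2" "skorokhod_close d1 x z"
      using close[of x z "dist x z + e / 2"] e by auto
    obtain d2 where d2: "d2 < dist z y + e / 2" "skorokhod_close d2 z y"
      using close[of z y "dist z y + e / 2"] e by auto
    have "dist x y \<le> d1 + d2" by (rule upper[OF skorokhod_close_trans[OF d1(2) d2(2)]])
    then show "dist x y \<le> dist x z + dist y z + e" using d1 d2 sym[of z y] by simp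
  qed
qed

end

lemma dist_coord_0_le: "dist (coord 0 x) (coord 0 y) \<le> dist x y"
  for x y :: "'a::metric_space cadlag"
proof -
  have "dist (coord 0 x) (coord 0 y) \<le> e" if "skorokhod_close e x y" for e
  proof -
    from that obtain l where l: "l \<in> time_changes"
      and c: "\<And>t. t \<in> {0..1} \<Longrightarrow> dist (coord t x) (coord (l t) y) \<le> e"
      unfolding skorokhod_close_def by auto
    show ?thesis using c[of 0] time_changes_ends[OF l] by simp
  qed
  then show ?thesis
    unfolding dist_cadlag_def using skorokhod_close_exists[of x y] by (intro cInf_greatest) auto
qed

lemma continuous_coord_0: "continuous_on UNIV (coord 0 :: 'a::metric_space cadlag \<Rightarrow> 'a)"
  unfolding continuous_on_iff by (metis dist_coord_0_le le_less_trans)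

lemma measurable_coord_0 [measurable]: "(coord 0 :: 'a::metric_space cadlag \<Rightarrow> 'a) \<in> borel_measurable borel"
  by (rule borel_measurable_continuous_onI[OF continuous_coord_0])



definition narrow_topology :: "'a::topological_space measure topology" where
  "narrow_topology = topology_generated_by
     {{\<mu> \<in> space (prob_algebra borel). (\<integral>x. f x \<partial>\<mu>) \<in> U} | f U.
        continuous_on UNIV (f :: 'a \<Rightarrow> real) \<and> bounded (range f) \<and> open U}"

lemma topspace_narrow_topology:
  "topspace (narrow_topology :: 'a::topological_space measure topology) = space (prob_algebra borel)"
proof -
  have "space (prob_algebra borel) \<in> {{\<mu> \<in> space (prob_algebra borel). (\<integral>x. f x \<partial>\<mu>) \<in> U} | f U.
        continuous_on UNIV (f :: 'a \<Rightarrow> real) \<and> bounded (range f) \<and> open U}"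
    by (rule CollectI, rule exI[of _ "\<lambda>_. 0"], rule exI[of _ UNIV]) auto
  then show ?thesis unfolding narrow_topology_def topology_generated_by_topspace by blast
qed

definition iota :: "'a set \<Rightarrow> 'a \<Rightarrow> 'b::{zero, infinity}" where
  "iota A x = (if x \<in> A then 0 else \<infinity>)"

text \<open>\<open>H(P|R)\<close>.  The integral of \<open>log (dP/dR)\<close> is the difference of the integrals of the positive
  and negative parts; the latter is always finite for probability measures.  Note that
  \<^const>\<open>entropy_density\<close> takes the reference measure first.\<close>

definition rel_entropy :: "'a measure \<Rightarrow> 'a measure \<Rightarrow> ereal" where
  "rel_entropy P R =
     (if absolutely_continuous R P
      then enn2ereal (\<integral>\<^sup>+ x. ennreal (entropy_density (exp 1) R P x) \<partial>P)
         - enn2ereal (\<integral>\<^sup>+ x. ennreal (- entropy_density (exp 1) R P x) \<partial>P)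
      else \<infinity>)"

definition lsc :: "('a::topological_space \<Rightarrow> 'b::linorder) \<Rightarrow> bool" where
  "lsc f \<longleftrightarrow> (\<forall>x. \<forall>a<f x. \<forall>\<^sub>F y in nhds x. a < f y)"

definition coercive :: "('a::topological_space \<Rightarrow> ennreal) \<Rightarrow> bool" where
  "coercive f \<longleftrightarrow> (\<forall>a::real. compact {x. enn2ereal (f x) \<le> ereal a})"

definition log_prob :: "'a measure \<Rightarrow> 'a set \<Rightarrow> ereal" where
  "log_prob \<gamma> A = (if measure \<gamma> A = 0 then -\<infinity> else ereal (ln (measure \<gamma> A)))"

text \<open>Only the indices \<open>k \<ge> 1\<close> matter.\<close>

definition LDP :: "(nat \<Rightarrow> 'a::topological_space measure) \<Rightarrow> ('a \<Rightarrow> ennreal) \<Rightarrow> bool" where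
  "LDP \<gamma> I \<longleftrightarrow>
     (\<forall>k\<ge>1. \<gamma> k \<in> space (prob_algebra borel)) \<and> lsc I \<and>
     (\<forall>A\<in>sets borel.
        - (INF x\<in>interior A. enn2ereal (I x)) \<le> liminf (\<lambda>k. ereal (1 / real k) * log_prob (\<gamma> k) A) \<and>
        liminf (\<lambda>k. ereal (1 / real k) * log_prob (\<gamma> k) A)
          \<le> limsup (\<lambda>k. ereal (1 / real k) * log_prob (\<gamma> k) A) \<and>
        limsup (\<lambda>k. ereal (1 / real k) * log_prob (\<gamma> k) A) \<le> - (INF x\<in>closure A. enn2ereal (I x)))"

definition nbhds_in :: "'a topology \<Rightarrow> 'a \<Rightarrow> 'a set set" where
  "nbhds_in T x = {V. V \<subseteq> topspace T \<and> (\<exists>U. openin T U \<and> x \<in> U \<and> U \<subseteq> V)}"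

definition Gamma_lim :: "'a topology \<Rightarrow> (nat \<Rightarrow> 'a \<Rightarrow> ereal) \<Rightarrow> ('a \<Rightarrow> ereal) \<Rightarrow> bool" where
  "Gamma_lim T f g \<longleftrightarrow> (\<forall>x\<in>topspace T.
     (SUP V\<in>nbhds_in T x. liminf (\<lambda>k. INF y\<in>V. f k y)) = g x \<and>
     (SUP V\<in>nbhds_in T x. limsup (\<lambda>k. INF y\<in>V. f k y)) = g x)"

end

theory Submission
  imports Defs
begin

text \<open>
  Lower bound.  By Donsker--Varadhan, applied to \<open>k f\<close> minus its logarithmic moment on each fibre of
  \<open>X\<^sub>0\<close>, \<open>H(Q|R) / k\<close> is at least \<open>\<integral> f dQ - \<integral> \<Lambda>\<^sub>k d\<mu>\<^sub>0\<close> with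
  \<open>\<Lambda>\<^sub>k x = (1 / k) ln (\<integral> e\<^sup>k\<^sup>f dR\<^sup>k\<^sup>,\<^sup>x)\<close>.  If \<open>f\<close> is bounded continuous with \<open>0 \<le> f \<le> C\<close>, the upper
  large deviation bound gives \<open>\<Lambda>\<^sub>k \<longlonglongrightarrow> 0\<close> pointwise and boundedly, and \<open>C\<close> is an increasing limit of
  such \<open>f\<close>.

  Upper bound.  Up to a \<open>P\<close>-null set, split the path space into finitely many disjoint open sets \<open>A\<close>
  on which the test functions defining the given narrow neighbourhood are nearly constant.  With
  \<open>p A x = P(A | X\<^sub>0 = x)\<close>, recover \<open>P\<close> by the mixtures of the conditioned measures
  \<open>R\<^sup>k\<^sup>,\<^sup>x(\<sqdot> | A)\<close> with weights \<open>p A x\<close>.  Their entropy is at most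
  \<open>- \<integral> \<Sum>\<^sub>A p A x ln (R\<^sup>k\<^sup>,\<^sup>x A) d\<mu>\<^sub>0\<close>, and the lower large deviation bound gives
  \<open>limsup (- (1 / k) ln (R\<^sup>k\<^sup>,\<^sup>x A)) \<le> C \<omega>\<close> for every \<open>\<omega> \<in> A\<close> starting at \<open>x\<close>.  Integrating the latter
  against \<open>P\<close> needs neither a disintegration nor a measurable selection.  As the convergence is not
  uniform in \<open>x\<close>, the kernel is left unchanged on the set of those \<open>x\<close>, of vanishing mass, for which
  \<open>k\<close> is still too small.
\<close>

subsection \<open>Lower semicontinuous functions and narrow topology\<close>

text \<open>Lipschitz regularization: \<open>f n\<close> is the infimal convolution of the
  truncation min n C with n times the distance. Truncating keeps the values real and bounded by n;
  the infimal convolution is n-Lipschitz and increases with n.\<close>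

lemma lsc_approx:
  fixes C :: "'a::metric_space \<Rightarrow> ennreal"
  assumes "lsc C"
  obtains f :: "nat \<Rightarrow> 'a \<Rightarrow> real" where
    "\<And>n. continuous_on UNIV (f n)" "\<And>n x. 0 \<le> f n x" "\<And>n x. f n x \<le> real n"
    "incseq (\<lambda>n x. ennreal (f n x))" "\<And>x. (SUP n. ennreal (f n x)) = C x"
proof -
  define g where "g n y = enn2real (min (of_nat n) (C y))" for n y
  define f where "f n x = (INF y. g n y + real n * dist x y)" for n x
  have eg: "ennreal (g n y) = min (of_nat n) (C y)" for n y
    unfolding g_def by (intro ennreal_enn2real) (simp add: min_less_iff_disj of_nat_less_top)
  have g0: "0 \<le> g n y" for n y by (simp add: g_def)
  have gn: "g n y \<le> real n" for n y
  proof -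
    have "ennreal (g n y) \<le> ennreal (real n)" by (simp add: eg ennreal_of_nat_eq_real_of_nat)
    then show ?thesis by (simp add: ennreal_le_iff)
  qed
  have gC: "ennreal (g n y) \<le> C y" for n y by (simp add: eg)
  have gmono: "g m y \<le> g n y" if "m \<le> n" for m n y
  proof -
    have "ennreal (g m y) \<le> ennreal (g n y)" using that unfolding eg by (intro min.mono) auto
    then show ?thesis using g0 by (simp add: ennreal_le_iff)
  qed
  have bdd: "bdd_below (range (\<lambda>y. g n y + real n * dist x y))" for n x
    by (rule bdd_belowI[of _ 0]) (auto simp: g0)
  have fle: "f n x \<le> g n y + real n * dist x y" for n x y
    unfolding f_def by (rule cINF_lower[OF bdd]) simp
  have fge: "c \<le> f n x" if "\<And>y. c \<le> g n y + real n * dist x y" for c n x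
    unfolding f_def by (rule cINF_greatest) (use that in auto)
  have fg: "f n x \<le> g n x" for n x using fle[of n x x] by simp
  have f0: "0 \<le> f n x" for n x by (rule fge) (simp add: g0)
  have lip: "f n x \<le> f n z + real n * dist x z" for n x z
  proof -
    have "f n x - real n * dist x z \<le> f n z"
    proof (rule fge)
      fix y
      have "real n * dist x y \<le> real n * (dist x z + dist z y)"
        by (intro mult_left_mono dist_triangle) auto
      then show "f n x - real n * dist x z \<le> g n y + real n * dist z y"
        using fle[of n x y] by (simp add: algebra_simps)
    qed
    then show ?thesis by simp
  qed
  show ?thesis
  proof (rule that[of f])
    show "continuous_on UNIV (f n)" for n
    proof (rule lipschitz_on_continuous_on, rule lipschitz_onI)
      fix x y
      show "dist (f n x) (f n y) \<le> real n * dist x y"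
        using lip[of n x y] lip[of n y x] by (simp add: dist_real_def dist_commute abs_le_iff)
    qed simp
  next
    show "0 \<le> f n x" for n x by (rule f0)
    show "f n x \<le> real n" for n x using fg gn order_trans by blast
    show "incseq (\<lambda>n x. ennreal (f n x))"
    proof (intro incseq_SucI le_funI ennreal_leI fge)
      fix n and x y :: 'a
      have "real n * dist x y \<le> real (Suc n) * dist x y" by (intro mult_right_mono) auto
      then show "f n x \<le> g (Suc n) y + real (Suc n) * dist x y"
        using fle[of n x y] gmono[of n "Suc n" y] by simp
    qed
  next
    fix x
    show "(SUP n. ennreal (f n x)) = C x"
    proof (rule antisym)
      show "(SUP n. ennreal (f n x)) \<le> C x"
        by (rule SUP_least) (meson ennreal_leI fg gC order_trans)
      show "C x \<le> (SUP n. ennreal (f n x))"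
      proof (rule dense_le)
        fix b assume b: "b < C x"
        define a where "a = enn2real b"
        have a: "b = ennreal a" "0 \<le> a"
          using b by (auto simp: a_def top_unique less_top[symmetric] ennreal_enn2real_if)
        have "\<forall>\<^sub>F y in nhds x. b < C y" using assms b by (simp add: lsc_def)
        then obtain r where r: "r > 0" "\<And>y. dist y x < r \<Longrightarrow> b < C y"
          by (auto simp: eventually_nhds_metric)
        \<comment> \<open>Within distance r of x the truncation already exceeds a, because n is at
          least a; farther away the penalty is at least n r, hence at least a.\<close>
        obtain n where n: "real n \<ge> max a (a / r)" using real_arch_simple by blast
        have "a \<le> f n x"
        proof (rule fge)
          fix y
          show "a \<le> g n y + real n * dist x y"
          proof (cases "dist y x < r")
            case True
            have "b \<le> min (of_nat n) (C y)"
              using r(2)[OF True] n a by (auto simp: ennreal_of_nat_eq_real_of_nat intro: ennreal_leI)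
            then have "a \<le> g n y" using a by (simp add: eg[symmetric] ennreal_le_iff g0)
            then show ?thesis by (simp add: add_increasing2)
          next
            case False
            then have "(a / r) * r \<le> real n * dist x y"
              using n r a by (intro mult_mono) (auto simp: dist_commute)
            then show ?thesis using r g0[of n y] by simp
          qed
        qed
        then have "b \<le> ennreal (f n x)" using a by (simp add: ennreal_leI)
        also have "\<dots> \<le> (SUP n. ennreal (f n x))" by (rule SUP_upper) simp
        finally show "b \<le> (SUP n. ennreal (f n x))" .
      qed
    qed
  qed
qed

lemma nn_integral_eq_integral_bounded:
  fixes f :: "'a::topological_space \<Rightarrow> real"
  assumes P: "P \<in> space (prob_algebra borel)" and f: "f \<in> borel_measurable borel"
    and b: "\<And>x. 0 \<le> f x" "\<And>x. f x \<le> B"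
  shows "(\<integral>\<^sup>+x. ennreal (f x) \<partial>P) = ennreal (\<integral>x. f x \<partial>P)"
proof -
  interpret prob_space P using P by (simp add: space_prob_algebra)
  have [measurable]: "f \<in> borel_measurable P" 
    using P f by (simp add: space_prob_algebra cong: measurable_cong_sets)
  show ?thesis
    by (rule nn_integral_eq_integral) (use b in \<open>auto intro!: integrable_const_bound[of _ B]\<close>)
qed

text \<open>Monotone convergence. It presents the integral of a lower semicontinuous function as a
  supremum of narrowly continuous functionals of \<open>P\<close>.\<close>

lemma nn_integral_lsc:
  fixes C :: "'a::metric_space \<Rightarrow> ennreal"
  assumes "P \<in> space (prob_algebra borel)" "incseq (\<lambda>n x. ennreal (f n x))"
    "\<And>n. continuous_on UNIV (f n)" "\<And>n x. 0 \<le> f n x" "\<And>n x. f n x \<le> real n"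
    "\<And>x. (SUP n. ennreal (f n x)) = C x"
  shows "(\<integral>\<^sup>+x. C x \<partial>P) = (SUP n. ennreal (\<integral>x. f n x \<partial>P))"
proof -
  have f[measurable]: "f n \<in> borel_measurable borel" for n
    by (rule borel_measurable_continuous_onI[OF assms(3)])
  have [measurable]: "f n \<in> borel_measurable P" for n
    using assms(1) f by (simp add: space_prob_algebra cong: measurable_cong_sets)
  have "(\<integral>\<^sup>+x. C x \<partial>P) = (\<integral>\<^sup>+x. (SUP n. ennreal (f n x)) \<partial>P)" by (simp add: assms(6))
  also have "\<dots> = (SUP n. \<integral>\<^sup>+x. ennreal (f n x) \<partial>P)"
    by (rule nn_integral_monotone_convergence_SUP[OF assms(2)]) simp
  also have "\<dots> = (SUP n. ennreal (\<integral>x. f n x \<partial>P))"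
    using nn_integral_eq_integral_bounded[OF assms(1) f assms(4,5)] by simp
  finally show ?thesis .
qed

lemma lsc_indicator_open:
  assumes "open U"
  shows "lsc (indicator U :: 'a::topological_space \<Rightarrow> ennreal)"
  unfolding lsc_def
proof (intro allI impI)
  fix x and a :: ennreal assume a: "a < indicator U x"
  then have "x \<in> U" by (cases "x \<in> U") auto
  then show "\<forall>\<^sub>F y in nhds x. a < indicator U y"
    by (rule eventually_mono[OF eventually_nhds_in_open[OF assms]]) (use a \<open>x \<in> U\<close> in auto)
qed

text \<open>Indicators of open sets are lower semicontinuous, so the mass of an open set is a
  supremum of integrals of bounded continuous functions; the open sets are an intersection-stable
  generator.\<close>

lemma prob_measure_eqI_continuous:
  fixes P Q :: "'a::metric_space measure"
  assumes P: "P \<in> space (prob_algebra borel)" and Q: "Q \<in> space (prob_algebra borel)"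
    and eq: "\<And>f :: 'a \<Rightarrow> real. continuous_on UNIV f \<Longrightarrow> bounded (range f) \<Longrightarrow> (\<integral>x. f x \<partial>P) = (\<integral>x. f x \<partial>Q)"
  shows "P = Q"
proof (rule measure_eqI_generator_eq[where E = "{U. open U}" and \<Omega> = UNIV and A = "\<lambda>_. UNIV"])
  show "Int_stable {U :: 'a set. open U}" by (auto simp: Int_stable_def)
  show "sets P = sigma_sets UNIV {U. open U}" "sets Q = sigma_sets UNIV {U. open U}"
    using P Q by (auto simp: space_prob_algebra borel_def)
  interpret P: prob_space P using P by (simp add: space_prob_algebra)
  show "emeasure P UNIV \<noteq> \<infinity>" for i :: nat by simp
  fix U :: "'a set" assume "U \<in> {U. open U}"
  then have U: "open U" by simp
  obtain f :: "nat \<Rightarrow> 'a \<Rightarrow> real" where f: "\<And>n. continuous_on UNIV (f n)"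
    "\<And>n x. 0 \<le> f n x" "\<And>n x. f n x \<le> real n"
    "incseq (\<lambda>n x. ennreal (f n x))" "\<And>x. (SUP n. ennreal (f n x)) = indicator U x"
    using lsc_approx[OF lsc_indicator_open[OF U]] by metis
  have bd: "bounded (range (f n))" for n
    by (rule boundedI[of _ "real n"]) (use f(2,3) in auto)
  have "U \<in> sets P" "U \<in> sets Q" using P Q U by (auto simp: space_prob_algebra)
  then show "emeasure P U = emeasure Q U"
    using nn_integral_lsc[OF P f(4,1-3,5)] nn_integral_lsc[OF Q f(4,1-3,5)] eq[OF f(1) bd]
    by simp
qed auto

section \<open>Basic neighbourhoods in the narrow topology\<close>

lemma openin_narrow_topology_integral:
  assumes "continuous_on UNIV (f :: 'a::topological_space \<Rightarrow> real)" "bounded (range f)" "open U"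
  shows "openin narrow_topology {\<mu> \<in> space (prob_algebra borel). (\<integral>x. f x \<partial>\<mu>) \<in> U}"
  unfolding narrow_topology_def by (rule topology_generated_by_Basis) (use assms in blast)

text \<open>Induction over the generated topology: an intersection takes the union of the test
  functions and the smaller radius, a union uses one member containing \<open>P\<close>, and a
  generator uses that \<open>U\<close> contains a ball about the integral.\<close>

lemma narrow_topology_base:
  fixes P :: "'a::topological_space measure"
  assumes "openin narrow_topology U" "P \<in> U"
  shows "\<exists>F \<delta>. finite F \<and> 0 < \<delta> \<and> (\<forall>f\<in>F. continuous_on UNIV (f :: 'a \<Rightarrow> real) \<and> bounded (range f)) \<and>
    (\<forall>Q\<in>space (prob_algebra borel). (\<forall>f\<in>F. \<bar>(\<integral>x. f x \<partial>Q) - (\<integral>x. f x \<partial>P)\<bar> < \<delta>) \<longrightarrow> Q \<in> U)"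
  using assms(1)[unfolded narrow_topology_def openin_topology_generated_by_iff] assms(2)
proof (induction rule: generate_topology_on.induct)
  case Empty
  then show ?case by simp
next
  case (Int a b)
  from Int.IH(1)[OF IntD1[OF Int.prems]] obtain F :: "('a \<Rightarrow> real) set" and \<delta> where "finite F" "0 < \<delta>"
    "\<forall>f\<in>F. continuous_on UNIV f \<and> bounded (range f)"
    "\<forall>Q\<in>space (prob_algebra borel). (\<forall>f\<in>F. \<bar>(\<integral>x. f x \<partial>Q) - (\<integral>x. f x \<partial>P)\<bar> < \<delta>) \<longrightarrow> Q \<in> a"
    by (elim exE conjE)
  moreover from Int.IH(2)[OF IntD2[OF Int.prems]] obtain G :: "('a \<Rightarrow> real) set" and \<epsilon> where "finite G" "0 < \<epsilon>"
    "\<forall>f\<in>G. continuous_on UNIV f \<and> bounded (range f)"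
    "\<forall>Q\<in>space (prob_algebra borel). (\<forall>f\<in>G. \<bar>(\<integral>x. f x \<partial>Q) - (\<integral>x. f x \<partial>P)\<bar> < \<epsilon>) \<longrightarrow> Q \<in> b"
    by (elim exE conjE)
  ultimately show ?case by (intro exI[of _ "F \<union> G"] exI[of _ "min \<delta> \<epsilon>"]) auto
next
  case (UN K)
  then obtain k where k: "k \<in> K" "P \<in> k" by blast
  from UN.IH[OF k] show ?case using k(1) by (meson UnionI)
next
  case (Basis s)
  then obtain f U where f: "continuous_on UNIV (f :: 'a \<Rightarrow> real)" "bounded (range f)" "open U"
    and s: "s = {\<mu> \<in> space (prob_algebra borel). (\<integral>x. f x \<partial>\<mu>) \<in> U}" by blast
  then obtain \<delta> where "\<delta> > 0" "\<And>y. dist y (\<integral>x. f x \<partial>P) < \<delta> \<Longrightarrow> y \<in> U"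
    using Basis open_dist by blast
  then show ?case using f s by (intro exI[of _ "{f}"] exI[of _ \<delta>]) (auto simp: dist_real_def)
qed

subsection \<open>Relative entropy\<close>

lemma entropy_density_exp1: "entropy_density (exp 1) R P x = ln (enn2real (RN_deriv R P x))"
  by (simp add: entropy_density_def log_def)

text \<open>The easy half of the Donsker-Varadhan formula. With d the density of \<open>P\<close>,
  integrate ln t \<le> t - 1 at t = exp (g x) / d x against \<open>P\<close>; the integral of exp g
  / d against \<open>P\<close> is at most that of exp g against \<open>R\<close>, hence at most
  1.\<close>

lemma rel_entropy_ge:
  fixes g :: "'a \<Rightarrow> real"
  assumes "prob_space R" "prob_space P" and sets: "sets P = sets R"
    and g[measurable]: "g \<in> borel_measurable R" and bd: "\<And>x. \<bar>g x\<bar> \<le> B"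
    and exp: "(\<integral>\<^sup>+x. ennreal (exp (g x)) \<partial>R) \<le> 1"
  shows "ereal (\<integral>x. g x \<partial>P) \<le> rel_entropy P R"
proof (cases "absolutely_continuous R P")
  case False
  then show ?thesis by (simp add: rel_entropy_def)
next
  case True
  interpret R: prob_space R by fact
  interpret P: prob_space P by fact
  define D where "D = RN_deriv R P"
  define d where "d x = enn2real (D x)" for x
  have [measurable]: "D \<in> borel_measurable R" "d \<in> borel_measurable R"
    unfolding D_def d_def by measurable
  have [measurable_cong]: "sets P = sets R" by fact
  have PD: "P = density R D" unfolding D_def by (simp add: R.density_RN_deriv[OF True] sets)
  have fin: "AE x in R. D x \<noteq> \<infinity>" unfolding D_def
    by (rule R.RN_deriv_finite[OF _ True]) (use sets P.sigma_finite_measure in auto)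
  have pos: "AE x in P. 0 < d x"
    unfolding PD by (subst AE_density, measurable) (use fin in \<open>auto simp: d_def enn2real_positive_iff less_top\<close>)
  have nnP: "(\<integral>\<^sup>+x. ennreal (\<phi> x) \<partial>P) = (\<integral>\<^sup>+x. ennreal (d x) * ennreal (\<phi> x) \<partial>R)"
    if [measurable]: "\<phi> \<in> borel_measurable R" for \<phi>
  proof -
    have "(\<integral>\<^sup>+x. ennreal (\<phi> x) \<partial>P) = (\<integral>\<^sup>+x. D x * ennreal (\<phi> x) \<partial>R)"
      unfolding PD by (rule nn_integral_density) measurable
    also have "\<dots> = (\<integral>\<^sup>+x. ennreal (d x) * ennreal (\<phi> x) \<partial>R)"
      by (rule nn_integral_cong_AE) (use fin in \<open>auto simp: d_def less_top\<close>)
    finally show ?thesis .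
  qed
  have dn: "0 \<le> d x" for x by (simp add: d_def)
  have neg: "(\<integral>\<^sup>+x. ennreal (- ln (d x)) \<partial>P) \<le> 1"
  proof -
    \<comment> \<open>From ln (1/t) \<le> 1/t. It makes the negative part integrable, so that the
      difference defining the entropy is never \<infinity> - \<infinity>.\<close>
    have "ennreal (d x) * ennreal (- ln (d x)) \<le> 1" for x
    proof (cases "0 < d x \<and> d x < 1")
      case True
      have "- ln (d x) \<le> 1 / d x" using ln_le_minus_one[of "1 / d x"] True by (simp add: ln_div)
      then have "d x * - ln (d x) \<le> 1" using True by (simp add: field_simps)
      then show ?thesis using True by (simp add: ennreal_mult'[symmetric] ennreal_le_1)
    next
      case False
      then consider "d x = 0" | "d x \<ge> 1" using dn[of x] by linarith
      then show ?thesis by cases (auto simp: ennreal_neg)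
    qed
    then have "(\<integral>\<^sup>+x. ennreal (- ln (d x)) \<partial>P) \<le> (\<integral>\<^sup>+x. 1 \<partial>R)"
      by (subst nnP, measurable) (intro nn_integral_mono, simp)
    then show ?thesis by (simp add: R.emeasure_space_1)
  qed
  have H: "rel_entropy P R = enn2ereal (\<integral>\<^sup>+x. ennreal (ln (d x)) \<partial>P) - enn2ereal (\<integral>\<^sup>+x. ennreal (- ln (d x)) \<partial>P)"
    using True by (simp add: rel_entropy_def entropy_density_exp1 d_def D_def)
  have ntop: "(\<integral>\<^sup>+x. ennreal (- ln (d x)) \<partial>P) < \<infinity>" using neg by (simp add: order_le_less_trans)
  show ?thesis
  proof (cases "(\<integral>\<^sup>+x. ennreal (ln (d x)) \<partial>P) = \<infinity>")
    case True
    then show ?thesis using ntop unfolding H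
      by (cases "\<integral>\<^sup>+x. ennreal (- ln (d x)) \<partial>P") auto
  next
    case False
    have iL: "integrable P (\<lambda>x. ln (d x))"
      unfolding real_integrable_def using False ntop by (auto simp: less_top)
    have HL: "rel_entropy P R = ereal (\<integral>x. ln (d x) \<partial>P)"
      unfolding H real_lebesgue_integral_def[OF iL] using False ntop
      by (cases "\<integral>\<^sup>+x. ennreal (- ln (d x)) \<partial>P"; cases "\<integral>\<^sup>+x. ennreal (ln (d x)) \<partial>P") auto
    have ig: "integrable P g" by (rule P.integrable_const_bound[of _ B]) (use bd in auto)
    \<comment> \<open>Passing from \<open>P\<close> to \<open>R\<close> loses the set where d = 0,
      hence an inequality instead of an equality.\<close>
    have e1: "(\<integral>\<^sup>+x. ennreal (exp (g x) / d x) \<partial>P) \<le> 1"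
    proof -
      have "ennreal (d x) * ennreal (exp (g x) / d x) \<le> ennreal (exp (g x))" for x
        using dn[of x] by (cases "d x = 0") (auto simp: ennreal_mult'[symmetric])
      then have "(\<integral>\<^sup>+x. ennreal (exp (g x) / d x) \<partial>P) \<le> (\<integral>\<^sup>+x. ennreal (exp (g x)) \<partial>R)"
        by (subst nnP) (auto intro!: nn_integral_mono)
      then show ?thesis using exp by simp
    qed
    have ie: "integrable P (\<lambda>x. exp (g x) / d x)"
      by (rule integrableI_nonneg) (use e1 dn in \<open>auto intro: order_le_less_trans\<close>)
    have "ennreal (\<integral>x. exp (g x) / d x \<partial>P) \<le> 1"
      using nn_integral_eq_integral[OF ie] dn e1 by simp
    then have e2: "(\<integral>x. exp (g x) / d x \<partial>P) \<le> 1" by (simp add: ennreal_le_1)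
    have "(\<integral>x. g x \<partial>P) \<le> (\<integral>x. ln (d x) + (exp (g x) / d x - 1) \<partial>P)"
    proof (rule integral_mono_AE[OF ig])
      show "integrable P (\<lambda>x. ln (d x) + (exp (g x) / d x - 1))" using iL ie by auto
      show "AE x in P. g x \<le> ln (d x) + (exp (g x) / d x - 1)"
        using pos
      proof eventually_elim
        case (elim x)
        then show ?case using ln_le_minus_one[of "exp (g x) / d x"] by (simp add: ln_div)
      qed
    qed
    also have "\<dots> \<le> (\<integral>x. ln (d x) \<partial>P)" using iL ie e2 by (simp add: P.prob_space)
    finally show ?thesis by (simp add: HL)
  qed
qed

text \<open>Dropping the negative part of the log density only increases the value. Since everything
  left is nonnegative, no integrability has to be checked, and \<open>c\<close> has to dominate only
  where \<open>h\<close> is nonzero because the rest is null for the new measure.\<close>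

lemma rel_entropy_density_le:
  assumes "prob_space R" "prob_space (density R h)"
    and [measurable]: "h \<in> borel_measurable R"
    and c: "\<And>x. x \<in> space R \<Longrightarrow> h x \<noteq> 0 \<Longrightarrow> ennreal (ln (enn2real (h x))) \<le> c x"
  shows "rel_entropy (density R h) R \<le> enn2ereal (\<integral>\<^sup>+x. h x * c x \<partial>R)"
proof -
  interpret R: prob_space R by fact
  interpret P: prob_space "density R h" by fact
  have ac: "absolutely_continuous R (density R h)"
    by (rule absolutely_continuousI_density) measurable
  have RN: "AE x in R. h x = RN_deriv R (density R h) x"
    by (rule R.RN_deriv_unique) auto
  have "(\<integral>\<^sup>+x. ennreal (entropy_density (exp 1) R (density R h) x) \<partial>density R h)
      = (\<integral>\<^sup>+x. h x * ennreal (ln (enn2real (RN_deriv R (density R h) x))) \<partial>R)"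
    by (subst nn_integral_density) (auto simp: entropy_density_exp1)
  also have "\<dots> \<le> (\<integral>\<^sup>+x. h x * c x \<partial>R)"
  proof (rule nn_integral_mono_AE)
    show "AE x in R. h x * ennreal (ln (enn2real (RN_deriv R (density R h) x))) \<le> h x * c x"
      using RN AE_space
    proof eventually_elim
      case (elim x)
      then show ?case using c[of x] by (cases "h x = 0") (auto intro!: mult_left_mono)
    qed
  qed
  finally have le: "enn2ereal (\<integral>\<^sup>+x. ennreal (entropy_density (exp 1) R (density R h) x) \<partial>density R h)
     \<le> enn2ereal (\<integral>\<^sup>+x. h x * c x \<partial>R)" by (simp add: less_eq_ennreal.rep_eq)
  have "rel_entropy (density R h) R \<le> enn2ereal (\<integral>\<^sup>+x. ennreal (entropy_density (exp 1) R (density R h) x) \<partial>density R h)"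
    using ac by (simp add: rel_entropy_def ereal_diff_le_self)
  then show ?thesis using le by (rule order_trans)
qed

subsection \<open>Logarithmic moments\<close>

text \<open>The slack \<epsilon> makes the limsup bound strict, so it holds for all large k and can
  be exponentiated.\<close>

lemma LDP_closed_upper:
  assumes LDP: "LDP \<gamma> I" and F: "closed F" and c: "\<And>x. x \<in> F \<Longrightarrow> ennreal c \<le> I x" "0 \<le> c" and \<epsilon>: "0 < \<epsilon>"
  shows "\<forall>\<^sub>F k in sequentially. measure (\<gamma> k) F \<le> exp (real k * (\<epsilon> - c))"
proof -
  have "F \<in> sets borel" using F by simp
  then have "limsup (\<lambda>k. ereal (1 / real k) * log_prob (\<gamma> k) F) \<le> - (INF x\<in>F. enn2ereal (I x))"
    using LDP F unfolding LDP_def by (metis closure_closed)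
  also have "ereal c \<le> (INF x\<in>F. enn2ereal (I x))"
  proof (rule INF_greatest)
    fix x assume "x \<in> F"
    then have "enn2ereal (ennreal c) \<le> enn2ereal (I x)" using c(1) less_eq_ennreal.rep_eq by blast
    then show "ereal c \<le> enn2ereal (I x)" using c by (simp add: enn2ereal_ennreal)
  qed
  then have "- (INF x\<in>F. enn2ereal (I x)) \<le> ereal (- c)" using ereal_minus_le_minus by fastforce
  also have "ereal (- c) < ereal (\<epsilon> - c)" using \<epsilon> by simp
  finally have "limsup (\<lambda>k. ereal (1 / real k) * log_prob (\<gamma> k) F) < ereal (\<epsilon> - c)" .
  then have "\<forall>\<^sub>F k in sequentially. ereal (1 / real k) * log_prob (\<gamma> k) F < ereal (\<epsilon> - c)"
    by (rule Limsup_lessD)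
  then show ?thesis using eventually_gt_at_top[of 0]
  proof eventually_elim
    case (elim k)
    show ?case
    proof (cases "measure (\<gamma> k) F = 0")
      case False
      then have pos: "measure (\<gamma> k) F > 0" using measure_nonneg[of "\<gamma> k" F] by linarith
      then have "ln (measure (\<gamma> k) F) / real k < \<epsilon> - c" using elim by (simp add: log_prob_def)
      then have "ln (measure (\<gamma> k) F) \<le> real k * (\<epsilon> - c)" using elim by (simp add: field_simps)
      then show ?thesis using pos by (metis exp_le_cancel_iff exp_ln)
    qed simp
  qed
qed

text \<open>A case of the upper half of Varadhan's lemma. Cut the range of \<open>f\<close> into
  layers of height \<eta>: on layer i the integrand is at most exp (k (i + 1) \<eta>), while the
  probability of {f \<ge> i \<eta>} is at most exp (k (\<eta> - i \<eta>)), since there the rate is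
  at least i \<eta>. Each of the finitely many layers thus contributes at most exp (2 \<eta> k). The
  matching lower bound is just f \<ge> 0.\<close>

lemma LDP_log_moment_tendsto_0:
  fixes f :: "'a::topological_space \<Rightarrow> real"
  assumes LDP: "LDP \<gamma> I" and f: "continuous_on UNIV f" "\<And>x. 0 \<le> f x" "\<And>x. f x \<le> B"
    and le: "\<And>x. ennreal (f x) \<le> I x"
  shows "(\<lambda>k. ln (\<integral>x. exp (real k * f x) \<partial>\<gamma> k) / real k) \<longlonglongrightarrow> 0"
proof (rule tendsto_sandwich[OF _ _ tendsto_const])
  have fm: "f \<in> borel_measurable borel" by (rule borel_measurable_continuous_onI[OF f(1)])
  have lower: "1 \<le> (\<integral>x. exp (real k * f x) \<partial>\<gamma> k)" and int: "integrable (\<gamma> k) (\<lambda>x. exp (real k * f x))"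
    if k: "k \<ge> 1" for k
  proof -
    have g: "\<gamma> k \<in> space (prob_algebra borel)" using LDP k by (simp add: LDP_def)
    then interpret prob_space "\<gamma> k" by (simp add: space_prob_algebra)
    have [measurable]: "f \<in> borel_measurable (\<gamma> k)"
      using g fm by (simp add: space_prob_algebra cong: measurable_cong_sets)
    show i: "integrable (\<gamma> k) (\<lambda>x. exp (real k * f x))"
      by (rule integrable_const_bound[of _ "exp (real k * B)"])
        (use f k in \<open>auto intro!: AE_I2 mult_left_mono\<close>)
    have "(\<integral>x. 1 \<partial>\<gamma> k) \<le> (\<integral>x. exp (real k * f x) \<partial>\<gamma> k)"
      by (rule integral_mono[OF _ i]) (use f in auto)
    then show "1 \<le> (\<integral>x. exp (real k * f x) \<partial>\<gamma> k)" by (simp add: prob_space)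
  qed
  show "\<forall>\<^sub>F k in sequentially. 0 \<le> ln (\<integral>x. exp (real k * f x) \<partial>\<gamma> k) / real k"
    using eventually_ge_at_top[of 1] by eventually_elim (simp add: lower)
  define U where "U k = ln (\<integral>x. exp (real k * f x) \<partial>\<gamma> k) / real k" for k
  have ev: "\<forall>\<^sub>F k in sequentially. U k < \<epsilon>" if \<epsilon>: "\<epsilon> > 0" for \<epsilon>
  proof -
    \<comment> \<open>The layers cost 2 \<eta> and the logarithm of their number, divided by k,
      costs less than \<eta>; the total 3 \<eta> stays below \<epsilon>.\<close>
    define \<eta> where "\<eta> = \<epsilon> / 4"
    have \<eta>: "\<eta> > 0" using \<epsilon> by (simp add: \<eta>_def)
    obtain N :: nat where N: "B / \<eta> \<le> real N" using real_arch_simple by blast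
    define F where "F i = {x. real i * \<eta> \<le> f x}" for i :: nat
    have cl: "closed (F i)" for i unfolding F_def by (intro closed_Collect_le f(1) continuous_on_const)
    have ev1: "\<forall>\<^sub>F k in sequentially. measure (\<gamma> k) (F i) \<le> exp (real k * (\<eta> - real i * \<eta>))" for i
    proof (rule LDP_closed_upper[OF LDP cl _ _ \<eta>])
      show "ennreal (real i * \<eta>) \<le> I x" if "x \<in> F i" for x
        using that le[of x] unfolding F_def by (metis (mono_tags) ennreal_leI mem_Collect_eq order_trans)
    qed (use \<eta> in simp)
    have "\<forall>\<^sub>F k in sequentially. \<forall>i\<in>{..N}. measure (\<gamma> k) (F i) \<le> exp (real k * (\<eta> - real i * \<eta>))"
      using ev1 by (simp add: eventually_ball_finite)
    moreover have "(\<lambda>k. ln (real (N + 1)) / real k) \<longlonglongrightarrow> 0" by real_asymp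
    then have "\<forall>\<^sub>F k in sequentially. ln (real (N + 1)) / real k < \<eta>" by (rule order_tendstoD) (rule \<eta>)
    ultimately show ?thesis using eventually_ge_at_top[of 1]
    proof eventually_elim
      case (elim k)
      have g: "\<gamma> k \<in> space (prob_algebra borel)" using LDP elim by (simp add: LDP_def)
      then interpret prob_space "\<gamma> k" by (simp add: space_prob_algebra)
      have [measurable]: "F i \<in> sets (\<gamma> k)" for i using g cl by (simp add: space_prob_algebra)
      \<comment> \<open>The layer containing f x already dominates the left-hand side; all other
        summands are nonnegative.\<close>
      have pt: "exp (real k * f x) \<le> (\<Sum>i\<le>N. exp (real k * (real i * \<eta> + \<eta>)) * indicator (F i) x)" for x
      proof -
        define i where "i = nat \<lfloor>f x / \<eta>\<rfloor>"
        have nn: "0 \<le> f x / \<eta>" using f \<eta> by simp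
        then have i: "real i \<le> f x / \<eta>" "f x / \<eta> \<le> real i + 1" unfolding i_def by linarith+
        have "f x / \<eta> \<le> B / \<eta>" using f \<eta> by (simp add: divide_right_mono)
        then have iN: "i \<le> N" using i N by linarith
        have i2: "real i * \<eta> \<le> f x" "f x \<le> real i * \<eta> + \<eta>" using i \<eta> by (simp_all add: field_simps)
        have "exp (real k * f x) \<le> exp (real k * (real i * \<eta> + \<eta>)) * indicator (F i) x"
          using i2 by (simp add: F_def mult_left_mono)
        also have "\<dots> \<le> (\<Sum>i\<le>N. exp (real k * (real i * \<eta> + \<eta>)) * indicator (F i) x)"
          using iN by (intro member_le_sum[where f = "\<lambda>i. exp (real k * (real i * \<eta> + \<eta>)) * indicator (F i) x"]) auto
        finally show ?thesis .
      qed
      have int1: "integrable (\<gamma> k) (\<lambda>x. exp (real k * (real i * \<eta> + \<eta>)) * indicator (F i) x)" for i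
        by (intro integrable_mult_right integrable_real_indicator) (auto simp: less_top[symmetric])
      have "(\<integral>x. exp (real k * f x) \<partial>\<gamma> k) \<le> (\<integral>x. (\<Sum>i\<le>N. exp (real k * (real i * \<eta> + \<eta>)) * indicator (F i) x) \<partial>\<gamma> k)"
      proof (rule integral_mono[OF _ _ pt])
        show "integrable (\<gamma> k) (\<lambda>x. exp (real k * f x))" using elim int by simp
        show "integrable (\<gamma> k) (\<lambda>x. \<Sum>i\<le>N. exp (real k * (real i * \<eta> + \<eta>)) * indicator (F i) x)"
          by (intro Bochner_Integration.integrable_sum int1)
      qed
      also have "\<dots> = (\<Sum>i\<le>N. exp (real k * (real i * \<eta> + \<eta>)) * measure (\<gamma> k) (F i))"
        by (subst Bochner_Integration.integral_sum[OF int1]) simp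
      also have "\<dots> \<le> (\<Sum>i\<le>N. exp (2 * \<eta> * real k))"
      proof (rule sum_mono)
        fix i assume "i \<in> {..N}"
        then have "exp (real k * (real i * \<eta> + \<eta>)) * measure (\<gamma> k) (F i)
            \<le> exp (real k * (real i * \<eta> + \<eta>)) * exp (real k * (\<eta> - real i * \<eta>))"
          using elim by (intro mult_left_mono) auto
        then show "exp (real k * (real i * \<eta> + \<eta>)) * measure (\<gamma> k) (F i) \<le> exp (2 * \<eta> * real k)"
          by (simp add: exp_add[symmetric] algebra_simps)
      qed
      finally have "(\<integral>x. exp (real k * f x) \<partial>\<gamma> k) \<le> real (N + 1) * exp (2 * \<eta> * real k)" by simp
      then have "ln (\<integral>x. exp (real k * f x) \<partial>\<gamma> k) \<le> ln (real (N + 1) * exp (2 * \<eta> * real k))"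
        using lower[of k] elim by (subst ln_le_cancel_iff) auto
      also have "\<dots> = ln (real (N + 1)) + 2 * \<eta> * real k" by (subst ln_mult) auto
      finally have "U k \<le> ln (real (N + 1)) / real k + 2 * \<eta>"
        using elim unfolding U_def by (simp add: field_simps)
      also have "\<dots> < \<eta> + 2 * \<eta>" using elim by simp
      also have "\<dots> \<le> \<epsilon>" using \<epsilon> by (simp add: \<eta>_def)
      finally show ?case .
    qed
  qed
  \<comment> \<open>Taking the maximum with 0 makes the lower half of the convergence of
    \<open>u\<close> trivial, so the eventual upper estimate \<open>ev\<close> is all that
    remains.\<close>
  define u where "u k = max 0 (U k)" for k
  show "\<forall>\<^sub>F k in sequentially. ln (\<integral>x. exp (real k * f x) \<partial>\<gamma> k) / real k \<le> u k"
    by (simp add: u_def U_def)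
  show "u \<longlonglongrightarrow> 0"
  proof (rule order_tendstoI)
    show "\<forall>\<^sub>F k in sequentially. a < u k" if "a < 0" for a using that by (simp add: u_def less_max_iff_disj)
    show "\<forall>\<^sub>F k in sequentially. u k < a" if "0 < a" for a
      using ev[OF that] by eventually_elim (use that in \<open>simp add: u_def\<close>)
  qed
qed

subsection \<open>Open partitions\<close>

text \<open>The bad offsets form a countable union of translates of \<open>S\<close>, and the reals
  are uncountable. It serves to place the cell boundaries away from atoms.\<close>

lemma exists_grid_avoiding_countable:
  fixes S :: "real set"
  assumes "countable S"
  shows "\<exists>t. \<forall>m::int. t + of_int m * \<eta> \<notin> S"
proof -
  have "countable (\<Union>m::int. (\<lambda>s. s - of_int m * \<eta>) ` S)" using assms by auto
  then have "(\<Union>m::int. (\<lambda>s. s - of_int m * \<eta>) ` S) \<noteq> UNIV" using uncountable_UNIV_real by metis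
  then obtain t where t: "t \<notin> (\<Union>m::int. (\<lambda>s. s - of_int m * \<eta>) ` S)" by blast
  have "t + of_int m * \<eta> \<notin> S" for m :: int
  proof
    assume "t + of_int m * \<eta> \<in> S"
    then have "(t + of_int m * \<eta>) - of_int m * \<eta> \<in> (\<lambda>s. s - of_int m * \<eta>) ` S" by (rule imageI)
    then show False using t by auto
  qed
  then show ?thesis by blast
qed

text \<open>The cells are preimages under \<open>f\<close> of the open intervals of a grid of mesh
  \<eta>. They are open and disjoint, and only the preimages of the grid points are missed; these
  are null once the grid avoids the atoms of the law of \<open>f\<close>.\<close>

lemma exists_open_partition_single:
  fixes f :: "'a::topological_space \<Rightarrow> real"
  assumes P: "P \<in> space (prob_algebra borel)" and f: "continuous_on UNIV f" "bounded (range f)" and \<eta>: "0 < \<eta>"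
  shows "\<exists>\<A>. finite \<A> \<and> disjoint \<A> \<and> (\<forall>A\<in>\<A>. open A) \<and> (AE x in P. x \<in> \<Union>\<A>) \<and>
    (\<forall>A\<in>\<A>. \<forall>x\<in>A. \<forall>y\<in>A. \<bar>f x - f y\<bar> \<le> \<eta>)"
proof -
  interpret P: prob_space P using P by (simp add: space_prob_algebra)
  have [measurable]: "f \<in> borel_measurable P"
    using P borel_measurable_continuous_onI[OF f(1)] by (simp add: space_prob_algebra cong: measurable_cong_sets)
  interpret D: prob_space "distr P borel f" by (rule P.prob_space_distr) measurable
  \<comment> \<open>The law of \<open>f\<close> is finite, so it has only countably many
    atoms.\<close>
  obtain t where t: "\<And>m::int. measure (distr P borel f) {t + of_int m * \<eta>} = 0"
    using exists_grid_avoiding_countable[OF D.countable_support, of \<eta>] by auto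
  have "AE x in distr P borel f. x \<noteq> t + of_int m * \<eta>" for m :: int
    by (rule AE_I[of _ _ "{t + of_int m * \<eta>}"]) (auto simp: D.emeasure_eq_measure t)
  then have "AE x in P. f x \<noteq> t + of_int m * \<eta>" for m :: int
    by (subst (asm) AE_distr_iff) auto
  then have ae: "AE x in P. \<forall>m::int. f x \<noteq> t + of_int m * \<eta>" by (subst AE_all_countable) auto
  define A where "A m = {x. t + of_int m * \<eta> < f x \<and> f x < t + of_int (m + 1) * \<eta>}" for m :: int
  obtain B where B: "\<And>x. \<bar>f x\<bar> \<le> B" using f(2) by (auto simp: bounded_iff)
  \<comment> \<open>All cells that meet the range of \<open>f\<close> have an index in this finite
    interval, since \<open>f\<close> is bounded by B.\<close>
  define K where "K = {\<lfloor>(- B - t) / \<eta>\<rfloor>..\<lfloor>(B - t) / \<eta>\<rfloor>}"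
  have Am: "m = \<lfloor>(f x - t) / \<eta>\<rfloor>" if "x \<in> A m" for x m
    using that \<eta> by (intro floor_unique[symmetric]) (auto simp: A_def field_simps)
  have cover: "x \<in> \<Union> (A ` K)" if x: "\<forall>m::int. f x \<noteq> t + of_int m * \<eta>" for x
  proof -
    define m where "m = \<lfloor>(f x - t) / \<eta>\<rfloor>"
    have "of_int m \<le> (f x - t) / \<eta>" "(f x - t) / \<eta> < of_int (m + 1)" unfolding m_def by linarith+
    then have "t + of_int m * \<eta> \<le> f x" "f x < t + of_int (m + 1) * \<eta>" using \<eta> by (simp_all add: field_simps)
    then have "x \<in> A m" using x by (simp add: A_def order_less_le) metis
    moreover have "m \<in> K" unfolding K_def m_def using B[of x] \<eta>
      by (auto intro!: floor_mono divide_right_mono)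
    ultimately show ?thesis by blast
  qed
  show ?thesis
  proof (intro exI[of _ "A ` K"] conjI ballI)
    show "finite (A ` K)" by (simp add: K_def)
    show "disjoint (A ` K)" using Am by (auto simp: disjoint_def)
    show "open S" if "S \<in> A ` K" for S
      using that unfolding A_def by (auto intro!: open_Collect_conj open_Collect_less f(1) continuous_on_const)
    show "AE x in P. x \<in> \<Union> (A ` K)" using ae by eventually_elim (rule cover)
    show "\<bar>f x - f y\<bar> \<le> \<eta>" if "S \<in> A ` K" "x \<in> S" "y \<in> S" for S x y
      using that by (auto simp: A_def algebra_simps)
  qed
qed

text \<open>Common refinement: intersecting two such partitions keeps the cells open and disjoint,
  and the two exceptional null sets unite to a null set.\<close>

lemma exists_open_partition:
  fixes F :: "('a::topological_space \<Rightarrow> real) set"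
  assumes P: "P \<in> space (prob_algebra borel)" and \<eta>: "0 < \<eta>"
    and F: "finite F" "\<forall>f\<in>F. continuous_on UNIV f \<and> bounded (range f)"
  shows "\<exists>\<A>. finite \<A> \<and> disjoint \<A> \<and> (\<forall>A\<in>\<A>. open A) \<and> (AE x in P. x \<in> \<Union>\<A>) \<and>
    (\<forall>f\<in>F. \<forall>A\<in>\<A>. \<forall>x\<in>A. \<forall>y\<in>A. \<bar>f x - f y\<bar> \<le> \<eta>)"
  using F
proof (induction rule: finite_induct)
  case empty
  show ?case by (rule exI[of _ "{UNIV}"]) (auto simp: disjoint_def)
next
  case (insert f F)
  obtain \<A> where A: "finite \<A>" "disjoint \<A>" "\<forall>A\<in>\<A>. open A" "AE x in P. x \<in> \<Union>\<A>"
    "\<forall>f\<in>F. \<forall>A\<in>\<A>. \<forall>x\<in>A. \<forall>y\<in>A. \<bar>f x - f y\<bar> \<le> \<eta>" using insert by auto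
  obtain \<B> where B: "finite \<B>" "disjoint \<B>" "\<forall>A\<in>\<B>. open A" "AE x in P. x \<in> \<Union>\<B>"
    "\<forall>A\<in>\<B>. \<forall>x\<in>A. \<forall>y\<in>A. \<bar>f x - f y\<bar> \<le> \<eta>"
    using exists_open_partition_single[OF P _ _ \<eta>, of f] insert by auto
  define \<C> where "\<C> = (\<lambda>(A, B). A \<inter> B) ` (\<A> \<times> \<B>)"
  show ?case
  proof (intro exI[of _ \<C>] conjI)
    show "finite \<C>" using A B by (simp add: \<C>_def)
    show "disjoint \<C>" using A(2) B(2) unfolding \<C>_def disjoint_def by blast
    show "\<forall>A\<in>\<C>. open A" using A(3) B(3) by (auto simp: \<C>_def)
    show "AE x in P. x \<in> \<Union>\<C>" using A(4) B(4) by eventually_elim (auto simp: \<C>_def)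
    show "\<forall>g\<in>insert f F. \<forall>A\<in>\<C>. \<forall>x\<in>A. \<forall>y\<in>A. \<bar>g x - g y\<bar> \<le> \<eta>"
      using A(5) B(5) unfolding \<C>_def by blast
  qed
qed

subsection \<open>The lower bound\<close>

text \<open>Path space is abstracted to a metric space, and the initial position to a continuous map
  \<open>X\<close>; \<open>M\<close> stands for the prescribed initial law.\<close>

locale kernel_LDP =
  fixes X :: "'w::metric_space \<Rightarrow> 'x::metric_space" and C :: "'w \<Rightarrow> ennreal"
    and R :: "nat \<Rightarrow> 'x \<Rightarrow> 'w measure" and M :: "'x measure"
  assumes X: "continuous_on UNIV X"
    and C: "lsc C"
    and R: "\<And>k. k \<ge> 1 \<Longrightarrow> R k \<in> borel \<rightarrow>\<^sub>M prob_algebra borel"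
    and RX: "\<And>k x. k \<ge> 1 \<Longrightarrow> emeasure (R k x) {\<omega>. X \<omega> = x} = 1"
    and LDP: "\<And>x. LDP (\<lambda>k. R k x) (\<lambda>\<omega>. C \<omega> + iota {\<omega>. X \<omega> = x} \<omega>)"
    and M: "M \<in> space (prob_algebra borel)"
begin

sublocale M: prob_space M using M by (simp add: space_prob_algebra)

lemma sets_M[measurable_cong, simp]: "sets M = sets borel"
  using M by (simp add: space_prob_algebra)

lemma space_M[simp]: "space M = UNIV"
  using sets_eq_imp_space_eq[OF sets_M] by simp

lemma measurable_X[measurable]: "X \<in> borel_measurable borel"
  by (rule borel_measurable_continuous_onI[OF X])

lemma R_prob: "k \<ge> 1 \<Longrightarrow> R k x \<in> space (prob_algebra borel)"
  using measurable_space[OF R, of k x] by simp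

lemma sets_R: "k \<ge> 1 \<Longrightarrow> sets (R k x) = sets borel"
  using R_prob[of k x] by (simp add: space_prob_algebra)

lemma prob_R: "k \<ge> 1 \<Longrightarrow> prob_space (R k x)"
  using R_prob[of k x] by (simp add: space_prob_algebra)

lemma R_subprob: "k \<ge> 1 \<Longrightarrow> R k \<in> M \<rightarrow>\<^sub>M subprob_algebra borel"
  using measurable_prob_algebraD[OF R[of k]] by (simp cong: measurable_cong_sets)

text \<open>This lets functions of \<open>X\<close> be treated as constants when integrating against
  \<open>R k x\<close>.\<close>

lemma AE_R_X:
  assumes "k \<ge> 1"
  shows "AE \<omega> in R k x. X \<omega> = x"
proof -
  interpret prob_space "R k x" by (rule prob_R[OF assms])
  have S: "{\<omega>. X \<omega> = x} \<in> sets (R k x)"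
    unfolding sets_R[OF assms] by measurable
  have "prob {\<omega>. X \<omega> = x} = 1" using RX[OF assms, of x] by (simp add: emeasure_eq_measure)
  then show ?thesis using AE_prob_1 by fastforce
qed

definition mix :: "nat \<Rightarrow> 'w measure" where "mix k = M \<bind> R k"

lemma sets_mix: "k \<ge> 1 \<Longrightarrow> sets (mix k) = sets borel"
  unfolding mix_def by (rule sets_bind) (simp_all add: sets_R)

lemma prob_mix: "k \<ge> 1 \<Longrightarrow> prob_space (mix k)"
  unfolding mix_def by (rule M.prob_space_bind[OF _ R_subprob]) (simp_all add: prob_R)

lemma nn_integral_mix:
  assumes "k \<ge> 1" "f \<in> borel_measurable borel"
  shows "(\<integral>\<^sup>+\<omega>. f \<omega> \<partial>mix k) = (\<integral>\<^sup>+x. \<integral>\<^sup>+\<omega>. f \<omega> \<partial>R k x \<partial>M)"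
  unfolding mix_def by (rule nn_integral_bind[OF assms(2) R_subprob[OF assms(1)]])

lemma measurable_nn_integral_R:
  assumes "k \<ge> 1" "f \<in> borel_measurable borel"
  shows "(\<lambda>x. \<integral>\<^sup>+\<omega>. f \<omega> \<partial>R k x) \<in> borel_measurable borel"
  by (rule measurable_compose[OF measurable_prob_algebraD[OF R[OF assms(1)]] nn_integral_measurable_subprob_algebra[OF assms(2)]])

definition cost :: "nat \<Rightarrow> 'w measure \<Rightarrow> ereal" where
  "cost k P = ereal (1 / real k) * rel_entropy P (mix k) + iota {P. distr P borel X = M} P"

definition limit_cost :: "'w measure \<Rightarrow> ereal" where
  "limit_cost P = enn2ereal (\<integral>\<^sup>+ \<omega>. C \<omega> \<partial>P) + iota {P. distr P borel X = M} P"

section \<open>Exponential moments on the fibres of \<open>X\<close>\<close>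

definition moment :: "('w \<Rightarrow> real) \<Rightarrow> nat \<Rightarrow> 'x \<Rightarrow> real" where
  "moment f k x = (\<integral>\<omega>. exp (real k * f \<omega>) \<partial>R k x)"

context
  fixes f :: "'w \<Rightarrow> real" and B :: real
  assumes f: "continuous_on UNIV f" "\<And>\<omega>. 0 \<le> f \<omega>" "\<And>\<omega>. f \<omega> \<le> B"
begin

lemma measurable_f[measurable]: "f \<in> borel_measurable borel"
  by (rule borel_measurable_continuous_onI[OF f(1)])

lemma nn_integral_moment:
  assumes k: "k \<ge> 1"
  shows "(\<integral>\<^sup>+\<omega>. ennreal (exp (real k * f \<omega>)) \<partial>R k x) = ennreal (moment f k x)"
  unfolding moment_def
  by (rule nn_integral_eq_integral_bounded[OF R_prob[OF k], where B = "exp (real k * B)"])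
    (use f k in \<open>auto intro!: mult_left_mono\<close>)

lemma moment_ge_1:
  assumes k: "k \<ge> 1"
  shows "1 \<le> moment f k x"
proof -
  interpret prob_space "R k x" by (rule prob_R[OF k])
  have "(\<integral>\<^sup>+\<omega>. 1 \<partial>R k x) \<le> (\<integral>\<^sup>+\<omega>. ennreal (exp (real k * f \<omega>)) \<partial>R k x)"
    by (rule nn_integral_mono) (use f in auto)
  then show ?thesis by (simp add: nn_integral_moment[OF k] emeasure_space_1)
qed

lemma moment_le:
  assumes k: "k \<ge> 1"
  shows "moment f k x \<le> exp (real k * B)"
proof -
  interpret prob_space "R k x" by (rule prob_R[OF k])
  have "(\<integral>\<^sup>+\<omega>. ennreal (exp (real k * f \<omega>)) \<partial>R k x) \<le> (\<integral>\<^sup>+\<omega>. ennreal (exp (real k * B)) \<partial>R k x)"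
    by (rule nn_integral_mono) (use f in \<open>auto intro!: ennreal_leI mult_left_mono\<close>)
  then show ?thesis by (simp add: nn_integral_moment[OF k] emeasure_space_1)
qed

lemma measurable_moment:
  assumes k: "k \<ge> 1"
  shows "moment f k \<in> borel_measurable borel"
proof -
  have "moment f k = (\<lambda>x. enn2real (\<integral>\<^sup>+\<omega>. ennreal (exp (real k * f \<omega>)) \<partial>R k x))"
    using order_trans[OF zero_le_one moment_ge_1[OF k]] by (simp add: nn_integral_moment[OF k] fun_eq_iff)
  moreover have [measurable]: "(\<lambda>x. \<integral>\<^sup>+\<omega>. ennreal (exp (real k * f \<omega>)) \<partial>R k x) \<in> borel_measurable borel"
    by (rule measurable_nn_integral_R[OF k]) measurable
  ultimately show ?thesis by simp
qed

lemma ln_moment_bounds: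
  assumes k: "k \<ge> 1"
  shows "0 \<le> ln (moment f k x)" "ln (moment f k x) \<le> real k * B"
proof -
  show "0 \<le> ln (moment f k x)" using moment_ge_1[OF k] by simp
  have "ln (moment f k x) \<le> ln (exp (real k * B))"
    using moment_ge_1[OF k, of x] moment_le[OF k, of x] by (subst ln_le_cancel_iff) auto
  then show "ln (moment f k x) \<le> real k * B" by simp
qed

text \<open>The exponential moment is normalized separately on each fibre of \<open>X\<close>, which makes a
  disintegration of \<open>Q\<close> unnecessary.\<close>

lemma entropy_lower_bound:
  assumes k: "k \<ge> 1" and Q: "Q \<in> space (prob_algebra borel)" "distr Q borel X = M"
  shows "ereal ((\<integral>\<omega>. f \<omega> \<partial>Q) - (\<integral>x. ln (moment f k x) / real k \<partial>M)) \<le> ereal (1 / real k) * rel_entropy Q (mix k)"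
proof -
  note [measurable] = measurable_moment[OF k]
  interpret Q: prob_space Q using Q by (simp add: space_prob_algebra)
  have [measurable_cong]: "sets Q = sets borel" using Q by (simp add: space_prob_algebra)
  have [measurable_cong]: "sets (mix k) = sets borel" by (rule sets_mix[OF k])
  define g where "g \<omega> = real k * f \<omega> - ln (moment f k (X \<omega>))" for \<omega>
  have [measurable]: "g \<in> borel_measurable borel" unfolding g_def by measurable
  have bd: "\<bar>g \<omega>\<bar> \<le> real k * B" for \<omega>
    using ln_moment_bounds[OF k, of "X \<omega>"] mult_left_mono[OF f(2)[of \<omega>], of "real k"]
      mult_left_mono[OF f(3)[of \<omega>], of "real k"]
    by (simp add: g_def abs_le_iff)
  have inner: "(\<integral>\<^sup>+\<omega>. ennreal (exp (g \<omega>)) \<partial>R k x) = 1" for x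
  proof -
    interpret prob_space "R k x" by (rule prob_R[OF k])
    have [measurable_cong]: "sets (R k x) = sets borel" by (rule sets_R[OF k])
    have m: "0 < moment f k x" using moment_ge_1[OF k, of x] by linarith
    have "(\<integral>\<^sup>+\<omega>. ennreal (exp (g \<omega>)) \<partial>R k x) = (\<integral>\<^sup>+\<omega>. ennreal (exp (real k * f \<omega>)) * ennreal (1 / moment f k x) \<partial>R k x)"
    proof (rule nn_integral_cong_AE)
      show "AE \<omega> in R k x. ennreal (exp (g \<omega>)) = ennreal (exp (real k * f \<omega>)) * ennreal (1 / moment f k x)"
        using AE_R_X[OF k, of x]
        by eventually_elim (use m in \<open>simp add: g_def exp_diff ennreal_mult'[symmetric]\<close>)
    qed
    also have "\<dots> = ennreal (moment f k x) * ennreal (1 / moment f k x)"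
      by (subst nn_integral_multc) (simp_all add: nn_integral_moment[OF k])
    also have "\<dots> = 1" using m by (simp add: ennreal_mult'[symmetric])
    finally show ?thesis .
  qed
  have exp: "(\<integral>\<^sup>+\<omega>. ennreal (exp (g \<omega>)) \<partial>mix k) \<le> 1"
    by (subst nn_integral_mix[OF k]) (simp_all add: inner M.emeasure_space_1[simplified])
  have "ereal (\<integral>\<omega>. g \<omega> \<partial>Q) \<le> rel_entropy Q (mix k)"
    by (rule rel_entropy_ge[OF prob_mix[OF k] Q.prob_space_axioms _ _ bd exp])
      (use Q sets_mix[OF k] in \<open>auto simp: space_prob_algebra\<close>)
  then have "ereal (1 / real k) * ereal (\<integral>\<omega>. g \<omega> \<partial>Q) \<le> ereal (1 / real k) * rel_entropy Q (mix k)"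
    by (rule ereal_mult_left_mono) simp
  moreover have "(\<integral>\<omega>. g \<omega> \<partial>Q) = real k * (\<integral>\<omega>. f \<omega> \<partial>Q) - (\<integral>x. ln (moment f k x) \<partial>M)"
  proof -
    have "integrable Q f" by (rule Q.integrable_const_bound[of _ B]) (use f in auto)
    moreover have "integrable Q (\<lambda>\<omega>. ln (moment f k (X \<omega>)))"
      by (rule Q.integrable_const_bound[of _ "real k * B"]) (use ln_moment_bounds[OF k] in auto)
    \<comment> \<open>The normalization depends on the path only through \<open>X\<close>, so its
      integral is the same for all \<open>Q\<close> with marginal \<open>M\<close>. This makes the
      bound uniform over such \<open>Q\<close>.\<close>
    moreover have "(\<integral>x. ln (moment f k x) \<partial>M) = (\<integral>\<omega>. ln (moment f k (X \<omega>)) \<partial>Q)"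
      unfolding Q(2)[symmetric] by (rule integral_distr) measurable
    ultimately show ?thesis by (simp add: g_def)
  qed
  moreover have "(\<integral>x. ln (moment f k x) / real k \<partial>M) = (\<integral>x. ln (moment f k x) \<partial>M) / real k" by simp
  ultimately show ?thesis using k by (simp add: field_simps)
qed

text \<open>Each fibre has its own large deviation principle, which gives pointwise convergence; the
  common bound \<open>B\<close> then allows dominated convergence, so no uniformity in x is
  required.\<close>

lemma integral_log_moment_tendsto_0:
  assumes le: "\<And>\<omega>. ennreal (f \<omega>) \<le> C \<omega>"
  shows "(\<lambda>k. \<integral>x. ln (moment f k x) / real k \<partial>M) \<longlonglongrightarrow> 0"
\<comment> \<open>The shift removes the index 0, at which \<open>R\<close> is arbitrary and the
  moment need not be measurable.\<close>
proof (rule LIMSEQ_imp_Suc)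
  have [measurable]: "moment f (Suc k) \<in> borel_measurable borel" for k by (rule measurable_moment) simp
  have "(\<lambda>k. \<integral>x. ln (moment f (Suc k) x) / real (Suc k) \<partial>M) \<longlonglongrightarrow> (\<integral>x. 0 \<partial>M)"
  proof (rule integral_dominated_convergence[where w = "\<lambda>_. B"])
    show "AE x in M. (\<lambda>k. ln (moment f (Suc k) x) / real (Suc k)) \<longlonglongrightarrow> 0"
    proof (rule AE_I2)
      fix x
      have "(\<lambda>k. ln (moment f k x) / real k) \<longlonglongrightarrow> 0"
        unfolding moment_def
      proof (rule LDP_log_moment_tendsto_0[OF LDP f])
        show "ennreal (f \<omega>) \<le> C \<omega> + iota {\<omega>. X \<omega> = x} \<omega>" for \<omega>
          using le[of \<omega>] by (simp add: add_increasing2)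
      qed
      then show "(\<lambda>k. ln (moment f (Suc k) x) / real (Suc k)) \<longlonglongrightarrow> 0" by (rule LIMSEQ_Suc)
    qed
    show "AE x in M. norm (ln (moment f (Suc k) x) / real (Suc k)) \<le> B" for k
    proof (rule AE_I2)
      fix x
      show "norm (ln (moment f (Suc k) x) / real (Suc k)) \<le> B"
        using ln_moment_bounds[of "Suc k" x] by (simp add: field_simps)
    qed
  qed auto
  then show "(\<lambda>k. \<integral>x. ln (moment f (Suc k) x) / real (Suc k) \<partial>M) \<longlonglongrightarrow> 0" by simp
qed

end

section \<open>The liminf inequality\<close>

lemma nbhds_in_narrowI:
  assumes "P \<in> space (prob_algebra borel)" "continuous_on UNIV (f :: 'w \<Rightarrow> real)" "bounded (range f)" "open U"
    "(\<integral>\<omega>. f \<omega> \<partial>P) \<in> U"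
  shows "{Q \<in> space (prob_algebra borel). (\<integral>\<omega>. f \<omega> \<partial>Q) \<in> U} \<in> nbhds_in narrow_topology P"
  using openin_narrow_topology_integral[OF assms(2-4)] assms(1,5)
  unfolding nbhds_in_def topspace_narrow_topology by blast

lemma cost_eq_infinity: "distr P borel X \<noteq> M \<Longrightarrow> cost k P = \<infinity>"
  by (simp add: cost_def iota_def)

text \<open>If the marginal is wrong, a whole neighbourhood has infinite cost. Otherwise each
  approximant of \<open>C\<close> yields a lower bound uniform on a neighbourhood, and the supremum
  over the approximants gives the integral of \<open>C\<close>.\<close>

lemma Gamma_liminf:
  assumes P: "P \<in> space (prob_algebra borel)"
  shows "limit_cost P \<le> (SUP V\<in>nbhds_in narrow_topology P. liminf (\<lambda>k. INF Q\<in>V. cost k Q))"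
proof (cases "distr P borel X = M")
  case False
  have XP: "X \<in> borel_measurable Q" if "Q \<in> space (prob_algebra borel)" for Q
    using that by (simp add: space_prob_algebra cong: measurable_cong_sets)
  interpret P: prob_space P using P by (simp add: space_prob_algebra)
  have "distr P borel X \<in> space (prob_algebra borel)"
    using P.prob_space_distr[OF XP[OF P]] by (simp add: space_prob_algebra)
  then obtain \<phi> :: "'x \<Rightarrow> real" where \<phi>: "continuous_on UNIV \<phi>" "bounded (range \<phi>)"
    "(\<integral>x. \<phi> x \<partial>distr P borel X) \<noteq> (\<integral>x. \<phi> x \<partial>M)"
    using prob_measure_eqI_continuous[OF _ M] False by blast
  have [measurable]: "\<phi> \<in> borel_measurable borel" by (rule borel_measurable_continuous_onI[OF \<phi>(1)])
  have id: "(\<integral>x. \<phi> x \<partial>distr Q borel X) = (\<integral>\<omega>. \<phi> (X \<omega>) \<partial>Q)" if "Q \<in> space (prob_algebra borel)" for Q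
    by (rule integral_distr[OF XP[OF that]]) measurable
  \<comment> \<open>The test function \<phi> separates the marginal of \<open>P\<close> from
    \<open>M\<close>; composed with the continuous \<open>X\<close> it gives an open condition on
    \<open>Q\<close> that excludes every measure with marginal \<open>M\<close>.\<close>
  define V where "V = {Q \<in> space (prob_algebra borel). (\<integral>\<omega>. \<phi> (X \<omega>) \<partial>Q) \<in> - {\<integral>x. \<phi> x \<partial>M}}"
  have V: "V \<in> nbhds_in narrow_topology P"
    unfolding V_def
  proof (rule nbhds_in_narrowI[OF P])
    show "continuous_on UNIV (\<lambda>\<omega>. \<phi> (X \<omega>))" by (rule continuous_on_compose2[OF \<phi>(1) X]) simp
    show "bounded (range (\<lambda>\<omega>. \<phi> (X \<omega>)))" by (rule bounded_subset[OF \<phi>(2)]) auto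
  qed (use \<phi>(3) id[OF P] in auto)
  have "cost k Q = \<infinity>" if "Q \<in> V" for k Q
    using that id[of Q] by (intro cost_eq_infinity) (auto simp: V_def)
  then have "liminf (\<lambda>k. INF Q\<in>V. cost k Q) = \<infinity>"
    by (simp add: Liminf_const top_ereal_def[symmetric])
  then have "(SUP V\<in>nbhds_in narrow_topology P. liminf (\<lambda>k. INF Q\<in>V. cost k Q)) = \<infinity>"
    using SUP_upper[OF V, of "\<lambda>V. liminf (\<lambda>k. INF Q\<in>V. cost k Q)"] by simp
  then show ?thesis by simp
next
  case True
  obtain f :: "nat \<Rightarrow> 'w \<Rightarrow> real" where f: "\<And>n. continuous_on UNIV (f n)"
    "\<And>n x. 0 \<le> f n x" "\<And>n x. f n x \<le> real n"
    "incseq (\<lambda>n x. ennreal (f n x))" "\<And>x. (SUP n. ennreal (f n x)) = C x"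
    using lsc_approx[OF C] by metis
  have fC: "ennreal (f n \<omega>) \<le> C \<omega>" for n \<omega> unfolding f(5)[symmetric] by (rule SUP_upper) simp
  have bf: "bounded (range (f n))" for n by (rule boundedI[of _ "real n"]) (use f(2,3) in auto)
  define S where "S = (SUP V\<in>nbhds_in narrow_topology P. liminf (\<lambda>k. INF Q\<in>V. cost k Q))"
  have lower: "ereal (\<integral>\<omega>. f n \<omega> \<partial>P) \<le> S" for n
  proof (rule ereal_le_epsilon2)
    fix \<epsilon> :: real assume \<epsilon>: "0 < \<epsilon>"
    \<comment> \<open>Half of \<epsilon> is spent on the variation of the integral over
      \<open>V\<close>, the other half on the logarithmic moment.\<close>
    define V where "V = {Q \<in> space (prob_algebra borel). (\<integral>\<omega>. f n \<omega> \<partial>Q) \<in> {(\<integral>\<omega>. f n \<omega> \<partial>P) - \<epsilon> / 2 <..}}"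
    have V: "V \<in> nbhds_in narrow_topology P"
      unfolding V_def by (rule nbhds_in_narrowI[OF P f(1) bf]) (use \<epsilon> in auto)
    have "\<forall>\<^sub>F k in sequentially. (\<integral>x. ln (moment (f n) k x) / real k \<partial>M) < \<epsilon> / 2"
      by (rule order_tendstoD(2)[OF integral_log_moment_tendsto_0[OF f(1-3) fC]]) (use \<epsilon> in auto)
    then have "\<forall>\<^sub>F k in sequentially. ereal ((\<integral>\<omega>. f n \<omega> \<partial>P) - \<epsilon>) \<le> (INF Q\<in>V. cost k Q)"
      using eventually_ge_at_top[of 1]
    proof eventually_elim
      case (elim k)
      show ?case
      proof (rule INF_greatest)
        fix Q assume Q: "Q \<in> V"
        show "ereal ((\<integral>\<omega>. f n \<omega> \<partial>P) - \<epsilon>) \<le> cost k Q"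
        proof (cases "distr Q borel X = M")
          case False
          then show ?thesis by (simp add: cost_eq_infinity)
        next
          case True
          have "ereal ((\<integral>\<omega>. f n \<omega> \<partial>P) - \<epsilon>) \<le> ereal ((\<integral>\<omega>. f n \<omega> \<partial>Q) - (\<integral>x. ln (moment (f n) k x) / real k \<partial>M))"
            using Q elim by (auto simp: V_def)
          also have "\<dots> \<le> ereal (1 / real k) * rel_entropy Q (mix k)"
            using Q elim True by (intro entropy_lower_bound[OF f(1-3)]) (auto simp: V_def)
          finally show ?thesis using True by (simp add: cost_def iota_def)
        qed
      qed
    qed
    then have "ereal ((\<integral>\<omega>. f n \<omega> \<partial>P) - \<epsilon>) \<le> liminf (\<lambda>k. INF Q\<in>V. cost k Q)" by (rule Liminf_bounded)
    also have "\<dots> \<le> S" unfolding S_def by (rule SUP_upper[OF V])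
    finally have "ereal ((\<integral>\<omega>. f n \<omega> \<partial>P) - \<epsilon>) + ereal \<epsilon> \<le> S + ereal \<epsilon>" by (rule add_right_mono)
    then show "ereal (\<integral>\<omega>. f n \<omega> \<partial>P) \<le> S + ereal \<epsilon>" by simp
  qed
  \<comment> \<open>Nonnegativity is needed because \<open>e2ennreal\<close> sends negative values
    to 0.\<close>
  have S0: "0 \<le> S" using lower[of 0] by (rule order_trans[rotated]) (simp add: f(2))
  have "ennreal (\<integral>\<omega>. f n \<omega> \<partial>P) \<le> e2ennreal S" for n
    using e2ennreal_mono[OF lower[of n]] by (simp add: e2ennreal_ereal)
  then have "(\<integral>\<^sup>+\<omega>. C \<omega> \<partial>P) \<le> e2ennreal S"
    unfolding nn_integral_lsc[OF P f(4,1-3,5)] by (rule SUP_least)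
  then have "enn2ereal (\<integral>\<^sup>+\<omega>. C \<omega> \<partial>P) \<le> S"
    using S0 by (simp add: less_eq_ennreal.rep_eq enn2ereal_e2ennreal)
  then show ?thesis using True by (simp add: limit_cost_def iota_def S_def)
qed

end

subsection \<open>The recovery sequence\<close>

text \<open>Here \<epsilon> is the tolerated excess cost. The radius of the narrow neighbourhood
  enters separately, through the oscillation of the test functions on the cells.\<close>

locale recovery = kernel_LDP X C R M
  for X :: "'w::metric_space \<Rightarrow> 'x::metric_space" and C :: "'w \<Rightarrow> ennreal"
    and R :: "nat \<Rightarrow> 'x \<Rightarrow> 'w measure" and M :: "'x measure" +
  fixes P :: "'w measure" and \<A> :: "'w set set" and \<epsilon> :: real
  assumes P: "P \<in> space (prob_algebra borel)" and PX: "distr P borel X = M"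
    and finite_cost: "(\<integral>\<^sup>+\<omega>. C \<omega> \<partial>P) < \<infinity>"
    and \<A>: "finite \<A>" "disjoint \<A>" "\<And>A. A \<in> \<A> \<Longrightarrow> open A" "AE \<omega> in P. \<omega> \<in> \<Union>\<A>"
    and \<epsilon>: "0 < \<epsilon>"
begin

sublocale P: prob_space P using P by (simp add: space_prob_algebra)

lemma sets_P[measurable_cong, simp]: "sets P = sets borel"
  using P by (simp add: space_prob_algebra)

lemma A_borel[measurable]: "A \<in> \<A> \<Longrightarrow> A \<in> sets borel"
  using \<A>(3) by simp

section \<open>Cells and their conditional probabilities\<close>

lemma indicator_other:
  assumes "A \<in> \<A>" "A' \<in> \<A>" "A' \<noteq> A" "\<omega> \<in> A"
  shows "\<omega> \<notin> A'"
  using disjointD[OF \<A>(2) assms(1,2)] assms(3,4) by auto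

lemma sum_indicator_A:
  assumes "A \<in> \<A>" "\<omega> \<in> A"
  shows "(\<Sum>A\<in>\<A>. indicator A \<omega> * \<phi> A) = (\<phi> A :: ennreal)"
proof -
  have "(\<Sum>A\<in>\<A>. indicator A \<omega> * \<phi> A) = (\<Sum>A'\<in>{A}. indicator A' \<omega> * \<phi> A')"
    using assms indicator_other[OF assms(1) _ _ assms(2)] \<A>(1) by (intro sum.mono_neutral_right) auto
  then show ?thesis using assms(2) by simp
qed

text \<open>\<open>p A\<close> is a version of the conditional probability of \<open>A\<close> given \<open>X\<close> under \<open>P\<close>.\<close>

definition p :: "'w set \<Rightarrow> 'x \<Rightarrow> ennreal" where
  "p A = RN_deriv M (distr (density P (indicator A)) borel X)"

lemma measurable_p[measurable]: "p A \<in> borel_measurable borel"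
proof -
  have "p A \<in> borel_measurable M" unfolding p_def by (rule borel_measurable_RN_deriv)
  then show ?thesis by (simp cong: measurable_cong_sets)
qed

lemma nn_integral_X:
  assumes [measurable]: "\<phi> \<in> borel_measurable borel"
  shows "(\<integral>\<^sup>+x. \<phi> x \<partial>M) = (\<integral>\<^sup>+\<omega>. \<phi> (X \<omega>) \<partial>P)"
  unfolding PX[symmetric] by (rule nn_integral_distr) measurable

text \<open>The law of \<open>X\<close> under \<open>P\<close> restricted to A is dominated by
  \<open>M\<close>, so its density \<open>p A\<close> exists. This identity does the work of a
  disintegration, moving integrals between the initial space and the path space.\<close>

lemma nn_integral_p:
  assumes A[measurable]: "A \<in> \<A>" and [measurable]: "\<phi> \<in> borel_measurable borel"
  shows "(\<integral>\<^sup>+x. p A x * \<phi> x \<partial>M) = (\<integral>\<^sup>+\<omega>. indicator A \<omega> * \<phi> (X \<omega>) \<partial>P)"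
proof -
  let ?N = "distr (density P (indicator A)) borel X"
  have ac: "absolutely_continuous M ?N"
    unfolding absolutely_continuous_def
  proof
    fix S assume S: "S \<in> null_sets M"
    then have [measurable]: "S \<in> sets borel" by auto
    have "emeasure ?N S = emeasure (density P (indicator A)) (X -` S \<inter> space P)"
      by (subst emeasure_distr) auto
    also have "\<dots> = (\<integral>\<^sup>+\<omega>. indicator A \<omega> * indicator (X -` S \<inter> space P) \<omega> \<partial>P)"
      by (rule emeasure_density) measurable
    also have "\<dots> \<le> (\<integral>\<^sup>+\<omega>. indicator (X -` S \<inter> space P) \<omega> \<partial>P)"
      by (rule nn_integral_mono) (auto simp: indicator_def)
    also have "\<dots> = emeasure P (X -` S \<inter> space P)" by simp
    also have "\<dots> = emeasure M S" unfolding PX[symmetric] by (rule emeasure_distr[symmetric]) measurable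
    also have "\<dots> = 0" using S by auto
    finally show "S \<in> null_sets ?N" by auto
  qed
  have "density M (p A) = ?N"
    unfolding p_def by (rule M.density_RN_deriv[OF ac]) simp
  then have "(\<integral>\<^sup>+x. p A x * \<phi> x \<partial>M) = (\<integral>\<^sup>+x. \<phi> x \<partial>?N)"
    by (metis (no_types) nn_integral_density measurable_p assms(2) measurable_cong_sets sets_M)
  also have "\<dots> = (\<integral>\<^sup>+\<omega>. \<phi> (X \<omega>) \<partial>density P (indicator A))" by (rule nn_integral_distr) measurable
  also have "\<dots> = (\<integral>\<^sup>+\<omega>. indicator A \<omega> * \<phi> (X \<omega>) \<partial>P)" by (rule nn_integral_density) measurable
  finally show ?thesis .
qed

text \<open>The disjoint cells cover \<open>P\<close>-almost everything. Testing on all Borel sets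
  of initial points and using uniqueness of densities turns this into a pointwise identity.\<close>

lemma AE_sum_p: "AE x in M. (\<Sum>A\<in>\<A>. p A x) = 1"
proof (rule M.density_unique2)
  fix S assume S: "S \<in> sets M"
  then have [measurable]: "S \<in> sets borel" by simp
  have "(\<integral>\<^sup>+x\<in>S. (\<Sum>A\<in>\<A>. p A x) \<partial>M) = (\<integral>\<^sup>+x. (\<Sum>A\<in>\<A>. p A x * indicator S x) \<partial>M)"
    by (simp add: sum_distrib_right)
  also have "\<dots> = (\<Sum>A\<in>\<A>. \<integral>\<^sup>+x. p A x * indicator S x \<partial>M)" by (rule nn_integral_sum) simp
  also have "\<dots> = (\<Sum>A\<in>\<A>. \<integral>\<^sup>+\<omega>. indicator A \<omega> * indicator S (X \<omega>) \<partial>P)"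
    by (rule sum.cong[OF refl], rule nn_integral_p) auto
  also have "\<dots> = (\<integral>\<^sup>+\<omega>. (\<Sum>A\<in>\<A>. indicator A \<omega> * indicator S (X \<omega>)) \<partial>P)"
    by (rule nn_integral_sum[symmetric]) simp
  also have "\<dots> = (\<integral>\<^sup>+\<omega>. indicator S (X \<omega>) \<partial>P)"
    by (rule nn_integral_cong_AE, use \<A>(4) in eventually_elim) (auto simp: sum_indicator_A)
  also have "\<dots> = (\<integral>\<^sup>+x\<in>S. 1 \<partial>M)" by (subst nn_integral_X) auto
  finally show "(\<integral>\<^sup>+x\<in>S. (\<Sum>A\<in>\<A>. p A x) \<partial>M) = (\<integral>\<^sup>+x\<in>S. 1 \<partial>M)" .
qed (auto cong: measurable_cong_sets)

text \<open>\<open>R 0\<close> is arbitrary, so \<open>w 0\<close> is set to \<open>0\<close> to make \<open>limsup\<close> measurable.\<close>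

definition w :: "nat \<Rightarrow> 'w set \<Rightarrow> 'x \<Rightarrow> ennreal" where
  "w k A x = (if k = 0 then 0 else if measure (R k x) A = 0 then \<infinity>
    else ennreal (- ln (measure (R k x) A) / real k))"

lemma measurable_w[measurable]:
  assumes A: "A \<in> \<A>"
  shows "w k A \<in> borel_measurable borel"
proof (cases "k = 0")
  case False
  then have k: "k \<ge> 1" by simp
  have "(\<lambda>x. emeasure (R k x) A) \<in> borel_measurable borel"
    by (rule measurable_compose[OF measurable_prob_algebraD[OF R[OF k]] measurable_emeasure_subprob_algebra[OF A_borel[OF A]]])
  then have [measurable]: "(\<lambda>x. measure (R k x) A) \<in> borel_measurable borel" unfolding measure_def by simp
  show ?thesis using False unfolding w_def by simp
qed (simp add: w_def[abs_def])

text \<open>Probabilities are at most 1, so the conversion to \<open>ennreal\<close> truncates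
  nothing, and a null cell gives \<infinity> on both sides.\<close>

lemma enn2ereal_w:
  assumes k: "k \<ge> 1"
  shows "enn2ereal (w k A x) = - (ereal (1 / real k) * log_prob (R k x) A)"
proof -
  interpret prob_space "R k x" by (rule prob_R[OF k])
  show ?thesis
  proof (cases "measure (R k x) A = 0")
    case False
    then have "0 < measure (R k x) A" using measure_nonneg[of "R k x" A] by linarith
    then have "ln (measure (R k x) A) \<le> 0" by simp
    then show ?thesis using k False by (simp add: w_def log_prob_def enn2ereal_ennreal divide_nonpos_nonneg)
  qed (use k in \<open>simp add: w_def log_prob_def\<close>)
qed

text \<open>The natural rate would be the infimum of \<open>C\<close> over the part of A above x,
  which need not be Borel in x. This limsup is Borel and, by \<open>u_le\<close>, lies below that
  infimum.\<close>

definition u :: "'w set \<Rightarrow> 'x \<Rightarrow> ennreal" where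
  "u A x = limsup (\<lambda>k. w k A x)"

lemma measurable_u[measurable]: "A \<in> \<A> \<Longrightarrow> u A \<in> borel_measurable borel"
  unfolding u_def by simp

text \<open>As A is open, \<omega> itself competes in the infimum of the lower large deviation bound
  on its own fibre, where the constraint term vanishes.\<close>

lemma u_le:
  assumes A: "A \<in> \<A>" and \<omega>: "\<omega> \<in> A"
  shows "u A (X \<omega>) \<le> C \<omega>"
  unfolding u_def Limsup_le_iff
proof (intro allI impI)
  fix y assume y: "C \<omega> < y"
  have "(INF \<omega>'\<in>interior A. enn2ereal (C \<omega>' + iota {\<omega>'. X \<omega>' = X \<omega>} \<omega>')) \<le> enn2ereal (C \<omega> + iota {\<omega>'. X \<omega>' = X \<omega>} \<omega>)"
    by (rule INF_lower) (use \<omega> \<A>(3)[OF A] in \<open>simp add: interior_open\<close>)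
  also have "\<dots> = enn2ereal (C \<omega>)" by (simp add: iota_def)
  also have "\<dots> < enn2ereal y" using y by (simp add: less_ennreal.rep_eq)
  finally have "- enn2ereal y < - (INF \<omega>'\<in>interior A. enn2ereal (C \<omega>' + iota {\<omega>'. X \<omega>' = X \<omega>} \<omega>'))"
    by simp
  also have "\<dots> \<le> liminf (\<lambda>k. ereal (1 / real k) * log_prob (R k (X \<omega>)) A)"
    using LDP[of "X \<omega>"] A_borel[OF A] unfolding LDP_def by blast
  finally have "\<forall>\<^sub>F k in sequentially. - enn2ereal y < ereal (1 / real k) * log_prob (R k (X \<omega>)) A"
    by (rule less_LiminfD)
  then show "\<forall>\<^sub>F k in sequentially. w k A (X \<omega>) < y"
    using eventually_ge_at_top[of 1]
    by eventually_elim (simp add: less_ennreal.rep_eq enn2ereal_w ereal_uminus_less_reorder)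
qed

text \<open>Pulled back to path space by \<open>nn_integral_p\<close>, the integrand is
  \<open>u A (X \<omega>)\<close> on the one cell A containing \<omega>, where \<open>u_le\<close>
  applies pointwise.\<close>

lemma nn_integral_p_u: "(\<Sum>A\<in>\<A>. \<integral>\<^sup>+x. p A x * u A x \<partial>M) \<le> (\<integral>\<^sup>+\<omega>. C \<omega> \<partial>P)"
proof -
  have "(\<Sum>A\<in>\<A>. \<integral>\<^sup>+x. p A x * u A x \<partial>M) = (\<Sum>A\<in>\<A>. \<integral>\<^sup>+\<omega>. indicator A \<omega> * u A (X \<omega>) \<partial>P)"
    by (rule sum.cong[OF refl], rule nn_integral_p) auto
  also have "\<dots> = (\<integral>\<^sup>+\<omega>. (\<Sum>A\<in>\<A>. indicator A \<omega> * u A (X \<omega>)) \<partial>P)"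
    by (rule nn_integral_sum[symmetric]) simp
  also have "\<dots> \<le> (\<integral>\<^sup>+\<omega>. C \<omega> \<partial>P)"
  proof (rule nn_integral_mono_AE)
    show "AE \<omega> in P. (\<Sum>A\<in>\<A>. indicator A \<omega> * u A (X \<omega>)) \<le> C \<omega>"
      using \<A>(4) by eventually_elim (auto simp: sum_indicator_A u_le)
  qed
  finally show ?thesis .
qed

text \<open>On \<open>G k\<close> the rate of convergence in the lower large deviation bound is controlled; outside of
  \<open>G k\<close> the recovery sequence keeps the kernel \<open>R k\<close>, which has zero entropy.\<close>

definition G :: "nat \<Rightarrow> 'x set" where
  "G k = {x. (\<Sum>A\<in>\<A>. p A x) = 1 \<and>
    (\<forall>A\<in>\<A>. p A x \<noteq> 0 \<longrightarrow> w k A x \<le> u A x + ennreal \<epsilon> \<and> w k A x < \<infinity>)}"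

lemma sets_G[measurable]: "G k \<in> sets borel"
  unfolding G_def using \<A>(1) by measurable

text \<open>Finite cost makes every \<open>p A x * u A x\<close> finite for almost all x, so
  \<open>u A x\<close> is finite wherever the weight is nonzero; there the limsup bound with slack
  \<epsilon> holds eventually.\<close>

lemma AE_eventually_G: "AE x in M. \<forall>\<^sub>F k in sequentially. x \<in> G k"
proof -
  have "AE x in M. p A x * u A x \<noteq> \<infinity>" if A: "A \<in> \<A>" for A
  proof (rule nn_integral_PInf_AE)
    have "(\<integral>\<^sup>+x. p A x * u A x \<partial>M) \<le> (\<Sum>A\<in>\<A>. \<integral>\<^sup>+x. p A x * u A x \<partial>M)"
      using A \<A>(1) by (intro member_le_sum) auto
    also have "\<dots> < \<infinity>" using nn_integral_p_u finite_cost by (rule order_le_less_trans)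
    finally show "(\<integral>\<^sup>+x. p A x * u A x \<partial>M) \<noteq> \<infinity>" by simp
  qed (use A in \<open>simp cong: measurable_cong_sets\<close>)
  then have "AE x in M. \<forall>A\<in>\<A>. p A x * u A x \<noteq> \<infinity>" using \<A>(1) by (subst AE_finite_all) auto
  then show ?thesis using AE_sum_p
  proof eventually_elim
    case (elim x)
    have "\<forall>\<^sub>F k in sequentially. p A x \<noteq> 0 \<longrightarrow> w k A x \<le> u A x + ennreal \<epsilon> \<and> w k A x < \<infinity>" if A: "A \<in> \<A>" for A
    proof (cases "p A x = 0")
      case False
      then have "u A x < \<infinity>" using elim A by (auto simp: ennreal_mult_eq_top_iff less_top)
      \<comment> \<open>Strictness relies on finiteness of \<open>u A x\<close>, and it also yields
        that \<open>w k A x\<close> is eventually finite.\<close>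
      then have "u A x < u A x + ennreal \<epsilon>" using \<epsilon> by (simp add: less_top)
      then have "\<forall>\<^sub>F k in sequentially. w k A x < u A x + ennreal \<epsilon>"
        unfolding u_def by (rule Limsup_lessD)
      then show ?thesis by eventually_elim (auto intro: order_less_le_trans)
    qed simp
    then have "\<forall>\<^sub>F k in sequentially. \<forall>A\<in>\<A>. p A x \<noteq> 0 \<longrightarrow> w k A x \<le> u A x + ennreal \<epsilon> \<and> w k A x < \<infinity>"
      using \<A>(1) by (simp add: eventually_ball_finite)
    then show ?case by eventually_elim (use elim in \<open>simp add: G_def\<close>)
  qed
qed

lemma emeasure_G_tendsto: "(\<lambda>k. emeasure M (- G k)) \<longlonglongrightarrow> 0"
proof -
  have "(\<lambda>k. \<integral>\<^sup>+x. indicator (- G k) x \<partial>M) \<longlonglongrightarrow> (\<integral>\<^sup>+x. 0 \<partial>M)"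
  proof (rule nn_integral_dominated_convergence[where w = "\<lambda>_. 1"])
    show "AE x in M. (\<lambda>k. indicator (- G k) x :: ennreal) \<longlonglongrightarrow> 0"
      using AE_eventually_G
    proof eventually_elim
      case (elim x)
      then show ?case by (intro tendsto_eventually) (auto elim!: eventually_mono)
    qed
  qed (auto simp: M.emeasure_space_1[simplified] indicator_def)
  then show ?thesis by simp
qed

section \<open>The recovery measures\<close>

definition h :: "nat \<Rightarrow> 'w \<Rightarrow> ennreal" where
  "h k \<omega> = (if X \<omega> \<in> G k then \<Sum>A\<in>\<A>. indicator A \<omega> * (p A (X \<omega>) / emeasure (R k (X \<omega>)) A) else 1)"

context
  fixes k :: nat
  assumes k: "k \<ge> 1"
begin

lemma measurable_emeasure_R[measurable]:
  assumes A: "A \<in> \<A>"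
  shows "(\<lambda>x. emeasure (R k x) A) \<in> borel_measurable borel"
  by (rule measurable_compose[OF measurable_prob_algebraD[OF R[OF k]] measurable_emeasure_subprob_algebra[OF A_borel[OF A]]])

lemma measurable_h[measurable]: "h k \<in> borel_measurable borel"
proof -
  have [measurable]: "(\<lambda>\<omega>. emeasure (R k (X \<omega>)) A) \<in> borel_measurable borel" if "A \<in> \<A>" for A
    by (rule measurable_compose[OF measurable_X measurable_emeasure_R[OF that]])
  show ?thesis unfolding h_def by measurable
qed

text \<open>On \<open>G k\<close> a nonzero weight forces finite \<open>w k A x\<close>, hence
  positive mass of A. A zero weight makes both sides 0, even over a null cell.\<close>

lemma p_divide_times:
  assumes "x \<in> G k" "A \<in> \<A>"
  shows "p A x / emeasure (R k x) A * emeasure (R k x) A = p A x"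
proof -
  interpret prob_space "R k x" by (rule prob_R[OF k])
  show ?thesis
  proof (cases "p A x = 0")
    case False
    then have "w k A x < \<infinity>" using assms by (simp add: G_def)
    then have "measure (R k x) A \<noteq> 0" using k by (auto simp: w_def)
    then have "emeasure (R k x) A \<noteq> 0" by (simp add: emeasure_eq_measure)
    then show ?thesis by (simp add: ennreal_divide_times ennreal_divide_self emeasure_eq_measure)
  qed simp
qed

text \<open>On the fibre over x the coefficients in \<open>h\<close> are almost surely constant and
  leave the inner integral. The marginal, the entropy and the narrow estimate all reduce to this
  formula.\<close>

lemma nn_integral_h:
  assumes g[measurable]: "g \<in> borel_measurable borel"
  shows "(\<integral>\<^sup>+\<omega>. h k \<omega> * g \<omega> \<partial>mix k) = (\<integral>\<^sup>+x. (if x \<in> G k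
    then \<Sum>A\<in>\<A>. p A x / emeasure (R k x) A * (\<integral>\<^sup>+\<omega>. indicator A \<omega> * g \<omega> \<partial>R k x)
    else \<integral>\<^sup>+\<omega>. g \<omega> \<partial>R k x) \<partial>M)"
proof (subst nn_integral_mix[OF k], simp, rule nn_integral_cong)
  fix x
  have [measurable_cong]: "sets (R k x) = sets borel" by (rule sets_R[OF k])
  show "(\<integral>\<^sup>+\<omega>. h k \<omega> * g \<omega> \<partial>R k x) = (if x \<in> G k
    then \<Sum>A\<in>\<A>. p A x / emeasure (R k x) A * (\<integral>\<^sup>+\<omega>. indicator A \<omega> * g \<omega> \<partial>R k x)
    else \<integral>\<^sup>+\<omega>. g \<omega> \<partial>R k x)"
  proof (cases "x \<in> G k")
    case True
    have "(\<integral>\<^sup>+\<omega>. h k \<omega> * g \<omega> \<partial>R k x) = (\<integral>\<^sup>+\<omega>. (\<Sum>A\<in>\<A>. p A x / emeasure (R k x) A * (indicator A \<omega> * g \<omega>)) \<partial>R k x)"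
      by (rule nn_integral_cong_AE, use AE_R_X[OF k, of x] in eventually_elim)
        (use True in \<open>simp add: h_def sum_distrib_left sum_distrib_right mult_ac\<close>)
    also have "\<dots> = (\<Sum>A\<in>\<A>. p A x / emeasure (R k x) A * (\<integral>\<^sup>+\<omega>. indicator A \<omega> * g \<omega> \<partial>R k x))"
      by (simp add: nn_integral_sum nn_integral_cmult)
    finally show ?thesis using True by simp
  next
    case False
    have "(\<integral>\<^sup>+\<omega>. h k \<omega> * g \<omega> \<partial>R k x) = (\<integral>\<^sup>+\<omega>. g \<omega> \<partial>R k x)"
      by (rule nn_integral_cong_AE, use AE_R_X[OF k, of x] in eventually_elim)
        (use False in \<open>simp add: h_def\<close>)
    then show ?thesis using False by simp
  qed
qed

definition Q :: "'w measure" where "Q = density (mix k) (h k)"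

lemma sets_Q[measurable_cong, simp]: "sets Q = sets borel"
  by (simp add: Q_def sets_mix[OF k])

lemma space_Q[simp]: "space Q = UNIV"
  using sets_eq_imp_space_eq[OF sets_Q] by simp

lemma measurable_h_mix: "h k \<in> borel_measurable (mix k)"
  using measurable_h by (simp cong: measurable_cong_sets add: sets_mix[OF k])

lemma nn_integral_Q:
  assumes "g \<in> borel_measurable borel"
  shows "(\<integral>\<^sup>+\<omega>. g \<omega> \<partial>Q) = (\<integral>\<^sup>+\<omega>. h k \<omega> * g \<omega> \<partial>mix k)"
  unfolding Q_def
  by (rule nn_integral_density) (use assms measurable_h_mix in \<open>simp_all cong: measurable_cong_sets add: sets_mix[OF k]\<close>)

text \<open>Over \<open>G k\<close> the cell masses cancel and the weights sum to 1; elsewhere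
  \<open>R k x\<close> is already a probability measure. Both the total mass and the marginal of
  \<open>Q\<close> follow.\<close>

lemma nn_integral_Q_X:
  assumes [measurable]: "\<phi> \<in> borel_measurable borel"
  shows "(\<integral>\<^sup>+\<omega>. \<phi> (X \<omega>) \<partial>Q) = (\<integral>\<^sup>+x. \<phi> x \<partial>M)"
proof (subst nn_integral_Q, simp, subst nn_integral_h, simp, rule nn_integral_cong)
  fix x
  interpret prob_space "R k x" by (rule prob_R[OF k])
  have [measurable_cong]: "sets (R k x) = sets borel" by (rule sets_R[OF k])
  have 1: "(\<integral>\<^sup>+\<omega>. \<phi> (X \<omega>) \<partial>R k x) = \<phi> x"
  proof -
    have "(\<integral>\<^sup>+\<omega>. \<phi> (X \<omega>) \<partial>R k x) = (\<integral>\<^sup>+\<omega>. \<phi> x \<partial>R k x)"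
      by (rule nn_integral_cong_AE, use AE_R_X[OF k, of x] in eventually_elim) simp
    then show ?thesis by (simp add: emeasure_space_1)
  qed
  have 2: "(\<integral>\<^sup>+\<omega>. indicator A \<omega> * \<phi> (X \<omega>) \<partial>R k x) = emeasure (R k x) A * \<phi> x" if A[measurable]: "A \<in> \<A>" for A
  proof -
    have "(\<integral>\<^sup>+\<omega>. indicator A \<omega> * \<phi> (X \<omega>) \<partial>R k x) = (\<integral>\<^sup>+\<omega>. indicator A \<omega> * \<phi> x \<partial>R k x)"
      by (rule nn_integral_cong_AE, use AE_R_X[OF k, of x] in eventually_elim) simp
    then show ?thesis by (simp add: nn_integral_multc)
  qed
  have "(\<Sum>A\<in>\<A>. p A x / emeasure (R k x) A * (\<integral>\<^sup>+\<omega>. indicator A \<omega> * \<phi> (X \<omega>) \<partial>R k x)) = \<phi> x" if x: "x \<in> G k"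
  proof -
    have "(\<Sum>A\<in>\<A>. p A x / emeasure (R k x) A * (\<integral>\<^sup>+\<omega>. indicator A \<omega> * \<phi> (X \<omega>) \<partial>R k x)) = (\<Sum>A\<in>\<A>. p A x * \<phi> x)"
      using p_divide_times[OF x] by (intro sum.cong refl) (simp add: 2 mult.assoc[symmetric])
    also have "\<dots> = \<phi> x" using x by (simp add: sum_distrib_right[symmetric] G_def)
    finally show ?thesis .
  qed
  then show "(if x \<in> G k then \<Sum>A\<in>\<A>. p A x / emeasure (R k x) A * (\<integral>\<^sup>+\<omega>. indicator A \<omega> * \<phi> (X \<omega>) \<partial>R k x)
    else \<integral>\<^sup>+\<omega>. \<phi> (X \<omega>) \<partial>R k x) = \<phi> x" using 1 by simp
qed

lemma Q_prob: "Q \<in> space (prob_algebra borel)"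
proof -
  have "emeasure Q (space Q) = (\<integral>\<^sup>+\<omega>. (\<lambda>_. 1) (X \<omega>) \<partial>Q)" by simp
  also have "\<dots> = 1" by (subst nn_integral_Q_X) (auto simp: M.emeasure_space_1[simplified])
  finally show ?thesis by (auto simp: space_prob_algebra intro: prob_spaceI)
qed

lemma distr_Q: "distr Q borel X = M"
proof (rule measure_eqI)
  fix S assume "S \<in> sets (distr Q borel X)"
  then have [measurable]: "S \<in> sets borel" by simp
  have "emeasure (distr Q borel X) S = (\<integral>\<^sup>+x. indicator S x \<partial>distr Q borel X)" by simp
  also have "\<dots> = (\<integral>\<^sup>+\<omega>. indicator S (X \<omega>) \<partial>Q)" by (rule nn_integral_distr) measurable
  also have "\<dots> = emeasure M S" by (subst nn_integral_Q_X) auto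
  finally show "emeasure (distr Q borel X) S = emeasure M S" .
qed simp

text \<open>On a cell, ln h = ln p - ln (R A) is at most - ln (R A), which is k times
  \<open>w\<close>, because p \<le> 1. Integrated over the fibre, cell A carries mass
  \<open>p A x\<close>, and on \<open>G k\<close> the rate \<open>w\<close> is at most
  \<open>u\<close> + \<epsilon>.\<close>

lemma rel_entropy_Q: "rel_entropy Q (mix k) \<le> enn2ereal (of_nat k * ((\<integral>\<^sup>+\<omega>. C \<omega> \<partial>P) + ennreal \<epsilon>))"
proof -
  \<comment> \<open>The value 0 off \<open>G k\<close> is right because \<open>h k\<close> is 1
    there and its logarithm vanishes.\<close>
  define c where "c \<omega> = (if X \<omega> \<in> G k then \<Sum>A\<in>\<A>. indicator A \<omega> * (of_nat k * w k A (X \<omega>)) else 0)" for \<omega>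
  have [measurable]: "(\<lambda>\<omega>. w k A (X \<omega>)) \<in> borel_measurable borel" if "A \<in> \<A>" for A
    by (rule measurable_compose[OF measurable_X measurable_w[OF that]])
  have [measurable]: "c \<in> borel_measurable borel" unfolding c_def by measurable
  have "rel_entropy Q (mix k) \<le> enn2ereal (\<integral>\<^sup>+\<omega>. h k \<omega> * c \<omega> \<partial>mix k)"
    unfolding Q_def
  proof (rule rel_entropy_density_le[OF prob_mix[OF k] _ measurable_h_mix])
    show "prob_space (density (mix k) (h k))" using Q_prob by (simp add: Q_def space_prob_algebra)
    fix \<omega> assume h: "h k \<omega> \<noteq> 0"
    let ?x = "X \<omega>"
    show "ennreal (ln (enn2real (h k \<omega>))) \<le> c \<omega>"
    proof (cases "?x \<in> G k")
      case True
      interpret prob_space "R k ?x" by (rule prob_R[OF k])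
      obtain A where A: "A \<in> \<A>" "\<omega> \<in> A"
        using h True \<A>(1) by (auto simp: h_def)
      have hk: "h k \<omega> = p A ?x / emeasure (R k ?x) A" and ck: "c \<omega> = of_nat k * w k A ?x"
        using True A by (simp_all add: h_def c_def sum_indicator_A)
      have p0: "p A ?x \<noteq> 0" using h hk by auto
      have p1: "p A ?x \<le> 1"
        using True A \<A>(1) member_le_sum[of A \<A> "\<lambda>A. p A ?x"] by (simp add: G_def)
      define q where "q = enn2real (p A ?x)"
      have "p A ?x < top" using p1 by (rule order_le_less_trans) simp
      then have q: "p A ?x = ennreal q" "0 < q" "q \<le> 1"
        using p0 p1 by (simp_all add: q_def enn2real_positive_iff zero_less_iff_neq_zero enn2real_leI)
      define m where "m = measure (R k ?x) A"
      have m: "0 < m" "emeasure (R k ?x) A = ennreal m"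
      proof -
        have "w k A ?x < \<infinity>" using True A p0 by (simp add: G_def)
        then have "m \<noteq> 0" using k by (auto simp: w_def m_def)
        then show "0 < m" by (simp add: m_def zero_less_measure_iff)
      qed (simp add: m_def emeasure_eq_measure)
      have "ln (enn2real (h k \<omega>)) = ln q - ln m"
        using q m by (simp add: hk divide_ennreal ln_div)
      also have "\<dots> \<le> - ln m" using q by simp
      finally have "ennreal (ln (enn2real (h k \<omega>))) \<le> ennreal (- ln m)" by (rule ennreal_leI)
      also have "\<dots> = of_nat k * w k A ?x"
        using k m by (simp add: w_def m_def[symmetric] ennreal_of_nat_eq_real_of_nat ennreal_mult'[symmetric])
      finally show ?thesis by (simp add: ck)
    qed (simp add: h_def c_def)
  qed
  also have "(\<integral>\<^sup>+\<omega>. h k \<omega> * c \<omega> \<partial>mix k) \<le> of_nat k * ((\<integral>\<^sup>+\<omega>. C \<omega> \<partial>P) + ennreal \<epsilon>)"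
  proof -
    have "(\<integral>\<^sup>+\<omega>. h k \<omega> * c \<omega> \<partial>mix k) \<le> (\<integral>\<^sup>+x. of_nat k * ((\<Sum>A\<in>\<A>. p A x * u A x) + ennreal \<epsilon>) \<partial>M)"
    proof (subst nn_integral_h, simp, rule nn_integral_mono)
      fix x
      interpret prob_space "R k x" by (rule prob_R[OF k])
      have [measurable_cong]: "sets (R k x) = sets borel" by (rule sets_R[OF k])
      have c0: "(\<integral>\<^sup>+\<omega>. c \<omega> \<partial>R k x) = 0" if "x \<notin> G k"
      proof -
        have "(\<integral>\<^sup>+\<omega>. c \<omega> \<partial>R k x) = (\<integral>\<^sup>+\<omega>. 0 \<partial>R k x)"
          by (rule nn_integral_cong_AE, use AE_R_X[OF k, of x] in eventually_elim) (use that in \<open>simp add: c_def\<close>)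
        then show ?thesis by simp
      qed
      have cA: "(\<integral>\<^sup>+\<omega>. indicator A \<omega> * c \<omega> \<partial>R k x) = emeasure (R k x) A * (of_nat k * w k A x)"
        if x: "x \<in> G k" and A[measurable]: "A \<in> \<A>" for A
      proof -
        have "(\<integral>\<^sup>+\<omega>. indicator A \<omega> * c \<omega> \<partial>R k x) = (\<integral>\<^sup>+\<omega>. indicator A \<omega> * (of_nat k * w k A x) \<partial>R k x)"
        proof (rule nn_integral_cong_AE, use AE_R_X[OF k, of x] in eventually_elim)
          fix \<omega> assume "X \<omega> = x"
          then show "indicator A \<omega> * c \<omega> = indicator A \<omega> * (of_nat k * w k A x)"
            using x A by (cases "\<omega> \<in> A") (simp_all add: c_def sum_indicator_A)
        qed
        then show ?thesis by (simp add: nn_integral_multc)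
      qed
      have "(\<Sum>A\<in>\<A>. p A x / emeasure (R k x) A * (\<integral>\<^sup>+\<omega>. indicator A \<omega> * c \<omega> \<partial>R k x))
          \<le> of_nat k * ((\<Sum>A\<in>\<A>. p A x * u A x) + ennreal \<epsilon>)" if x: "x \<in> G k"
      proof -
        have "(\<Sum>A\<in>\<A>. p A x / emeasure (R k x) A * (\<integral>\<^sup>+\<omega>. indicator A \<omega> * c \<omega> \<partial>R k x))
            = (\<Sum>A\<in>\<A>. p A x * (of_nat k * w k A x))"
          using p_divide_times[OF x] by (intro sum.cong refl) (simp add: cA[OF x] mult.assoc[symmetric])
        \<comment> \<open>Cells of zero weight contribute nothing, so it suffices that
          \<open>G k\<close> controls \<open>w\<close> where the weight is nonzero.\<close>
        also have "\<dots> \<le> (\<Sum>A\<in>\<A>. p A x * (of_nat k * (u A x + ennreal \<epsilon>)))"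
        proof (rule sum_mono)
          fix A assume "A \<in> \<A>"
          then show "p A x * (of_nat k * w k A x) \<le> p A x * (of_nat k * (u A x + ennreal \<epsilon>))"
            using x by (cases "p A x = 0") (auto simp: G_def intro!: mult_left_mono)
        qed
        also have "\<dots> = of_nat k * ((\<Sum>A\<in>\<A>. p A x * u A x) + (\<Sum>A\<in>\<A>. p A x) * ennreal \<epsilon>)"
          by (simp add: sum_distrib_left sum_distrib_right sum.distrib[symmetric] algebra_simps)
        finally show ?thesis using x by (simp add: G_def)
      qed
      then show "(if x \<in> G k then \<Sum>A\<in>\<A>. p A x / emeasure (R k x) A * (\<integral>\<^sup>+\<omega>. indicator A \<omega> * c \<omega> \<partial>R k x)
          else \<integral>\<^sup>+\<omega>. c \<omega> \<partial>R k x) \<le> of_nat k * ((\<Sum>A\<in>\<A>. p A x * u A x) + ennreal \<epsilon>)"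
        using c0 by simp
    qed
    also have "\<dots> = of_nat k * ((\<Sum>A\<in>\<A>. \<integral>\<^sup>+x. p A x * u A x \<partial>M) + ennreal \<epsilon>)"
      by (simp add: nn_integral_cmult nn_integral_add nn_integral_sum M.emeasure_space_1[simplified])
    also have "\<dots> \<le> of_nat k * ((\<integral>\<^sup>+\<omega>. C \<omega> \<partial>P) + ennreal \<epsilon>)"
      by (intro mult_left_mono add_right_mono nn_integral_p_u) simp
    finally show ?thesis .
  qed
  then have "enn2ereal (\<integral>\<^sup>+\<omega>. h k \<omega> * c \<omega> \<partial>mix k) \<le> enn2ereal (of_nat k * ((\<integral>\<^sup>+\<omega>. C \<omega> \<partial>P) + ennreal \<epsilon>))"
    by (simp add: less_eq_ennreal.rep_eq)
  finally show ?thesis .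
qed

text \<open>Over \<open>G k\<close> both measures give cell A the conditional mass
  \<open>p A x\<close>, so they differ only by how \<open>g\<close> varies inside cells, at most
  \<eta>. The complement of \<open>G k\<close> is paid for with the bound \<open>B\<close>.\<close>

lemma nn_integral_Q_ge:
  fixes g :: "'w \<Rightarrow> ennreal"
  assumes [measurable]: "g \<in> borel_measurable borel" and B: "\<And>\<omega>. g \<omega> \<le> B"
    and osc: "\<And>A \<omega> \<omega>'. A \<in> \<A> \<Longrightarrow> \<omega> \<in> A \<Longrightarrow> \<omega>' \<in> A \<Longrightarrow> g \<omega> \<le> g \<omega>' + \<eta>"
    and \<eta>: "\<eta> \<noteq> top"
  shows "(\<integral>\<^sup>+\<omega>. g \<omega> \<partial>P) \<le> (\<integral>\<^sup>+\<omega>. g \<omega> \<partial>Q) + \<eta> + B * emeasure M (- G k)"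
proof -
  define m where "m A = (INF \<omega>\<in>A. g \<omega>)" for A
  have m1: "m A \<le> g \<omega>" if "\<omega> \<in> A" for A \<omega>
    unfolding m_def using that by (rule INF_lower)
  have m2: "g \<omega> \<le> m A + \<eta>" if "A \<in> \<A>" "\<omega> \<in> A" for A \<omega>
  proof -
    have "g \<omega> - \<eta> \<le> m A"
      unfolding m_def
      by (rule INF_greatest) (use osc[OF that] \<eta> in \<open>simp add: ennreal_minus_le_iff add.commute\<close>)
    then show ?thesis using \<eta> by (simp add: ennreal_minus_le_iff add.commute)
  qed
  have "(\<integral>\<^sup>+\<omega>. g \<omega> \<partial>P) \<le> (\<integral>\<^sup>+\<omega>. (\<Sum>A\<in>\<A>. indicator A \<omega> * (m A * indicator (G k) (X \<omega>))) + \<eta> + B * indicator (- G k) (X \<omega>) \<partial>P)"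
  proof (rule nn_integral_mono_AE, use \<A>(4) in eventually_elim)
    fix \<omega> assume "\<omega> \<in> \<Union>\<A>"
    then obtain A where A: "A \<in> \<A>" "\<omega> \<in> A" by blast
    show "g \<omega> \<le> (\<Sum>A\<in>\<A>. indicator A \<omega> * (m A * indicator (G k) (X \<omega>))) + \<eta> + B * indicator (- G k) (X \<omega>)"
      using m2[OF A] B[of \<omega>] by (cases "X \<omega> \<in> G k") (auto simp: sum_indicator_A[OF A] add_increasing)
  qed
  also have "\<dots> = (\<integral>\<^sup>+\<omega>. (\<Sum>A\<in>\<A>. indicator A \<omega> * (m A * indicator (G k) (X \<omega>))) \<partial>P) + \<eta> + B * (\<integral>\<^sup>+\<omega>. indicator (- G k) (X \<omega>) \<partial>P)"
    by (simp add: nn_integral_add nn_integral_cmult P.emeasure_space_1)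
  also have "(\<integral>\<^sup>+\<omega>. indicator (- G k) (X \<omega>) \<partial>P) = emeasure M (- G k)"
    by (subst nn_integral_X[symmetric]) auto
  also have "(\<integral>\<^sup>+\<omega>. (\<Sum>A\<in>\<A>. indicator A \<omega> * (m A * indicator (G k) (X \<omega>))) \<partial>P)
      = (\<Sum>A\<in>\<A>. \<integral>\<^sup>+\<omega>. indicator A \<omega> * (m A * indicator (G k) (X \<omega>)) \<partial>P)"
    by (rule nn_integral_sum) simp
  also have "\<dots> = (\<Sum>A\<in>\<A>. \<integral>\<^sup>+x. p A x * (m A * indicator (G k) x) \<partial>M)"
    by (rule sum.cong[OF refl], rule nn_integral_p[symmetric]) auto
  also have "\<dots> = (\<integral>\<^sup>+x. (\<Sum>A\<in>\<A>. p A x * (m A * indicator (G k) x)) \<partial>M)"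
    by (rule nn_integral_sum[symmetric]) simp
  \<comment> \<open>Replacing \<open>g\<close> by its infimum on each cell only lowers the
    \<open>Q\<close>-integral, and the left-hand side vanishes off \<open>G k\<close>.\<close>
  also have "\<dots> \<le> (\<integral>\<^sup>+\<omega>. g \<omega> \<partial>Q)"
  proof (subst nn_integral_Q, simp, subst nn_integral_h, simp, rule nn_integral_mono)
    fix x
    have [measurable_cong]: "sets (R k x) = sets borel" by (rule sets_R[OF k])
    show "(\<Sum>A\<in>\<A>. p A x * (m A * indicator (G k) x)) \<le> (if x \<in> G k
        then \<Sum>A\<in>\<A>. p A x / emeasure (R k x) A * (\<integral>\<^sup>+\<omega>. indicator A \<omega> * g \<omega> \<partial>R k x)
        else \<integral>\<^sup>+\<omega>. g \<omega> \<partial>R k x)"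
    proof (cases "x \<in> G k")
      case True
      have "p A x * m A \<le> p A x / emeasure (R k x) A * (\<integral>\<^sup>+\<omega>. indicator A \<omega> * g \<omega> \<partial>R k x)"
        if A[measurable]: "A \<in> \<A>" for A
      proof -
        have "p A x * m A = p A x / emeasure (R k x) A * (emeasure (R k x) A * m A)"
          using p_divide_times[OF True A] by (simp add: mult.assoc[symmetric])
        also have "emeasure (R k x) A * m A = (\<integral>\<^sup>+\<omega>. indicator A \<omega> * m A \<partial>R k x)"
          by (simp add: nn_integral_multc)
        also have "\<dots> \<le> (\<integral>\<^sup>+\<omega>. indicator A \<omega> * g \<omega> \<partial>R k x)"
          by (rule nn_integral_mono) (auto simp: indicator_def m1)
        finally show ?thesis by (simp add: mult_left_mono)
      qed
      then show ?thesis using True by (auto intro!: sum_mono)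
    qed simp
  qed
  finally show ?thesis by (simp add: add_right_mono)
qed

end

end

text \<open>Adding b makes \<open>f\<close> nonnegative with upper bound 2 b; the shift cancels
  because both measures have mass 1. The reverse estimate comes from applying this to - f.\<close>

lemma (in recovery) integral_Q_ge:
  fixes f :: "'w \<Rightarrow> real"
  assumes k: "k \<ge> 1" and f[measurable]: "f \<in> borel_measurable borel" and b: "\<And>\<omega>. \<bar>f \<omega>\<bar> \<le> b"
    and osc: "\<And>A \<omega> \<omega>'. A \<in> \<A> \<Longrightarrow> \<omega> \<in> A \<Longrightarrow> \<omega>' \<in> A \<Longrightarrow> \<bar>f \<omega> - f \<omega>'\<bar> \<le> \<eta>" and \<eta>: "0 \<le> \<eta>"
  shows "(\<integral>\<omega>. f \<omega> \<partial>P) \<le> (\<integral>\<omega>. f \<omega> \<partial>Q k) + \<eta> + 2 * b * measure M (- G k)"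
proof -
  have bounds: "0 \<le> f \<omega> + b" "f \<omega> + b \<le> 2 * b" for \<omega> using b[of \<omega>] by auto
  have b0: "0 \<le> b" using b[of undefined] by linarith
  have "(\<integral>\<^sup>+\<omega>. ennreal (f \<omega> + b) \<partial>P) \<le> (\<integral>\<^sup>+\<omega>. ennreal (f \<omega> + b) \<partial>Q k) + ennreal \<eta> + ennreal (2 * b) * emeasure M (- G k)"
  proof (rule nn_integral_Q_ge[OF k])
    fix A \<omega> \<omega>' assume "A \<in> \<A>" "\<omega> \<in> A" "\<omega>' \<in> A"
    then have "f \<omega> + b \<le> (f \<omega>' + b) + \<eta>" using osc[of A \<omega> \<omega>'] by linarith
    then show "ennreal (f \<omega> + b) \<le> ennreal (f \<omega>' + b) + ennreal \<eta>"
      using bounds \<eta> by (simp add: ennreal_plus[symmetric] del: ennreal_plus)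
  qed (use bounds in \<open>auto intro: ennreal_leI\<close>)
  then have "ennreal (\<integral>\<omega>. f \<omega> + b \<partial>P) \<le> ennreal (\<integral>\<omega>. f \<omega> + b \<partial>Q k) + ennreal \<eta> + ennreal (2 * b * measure M (- G k))"
    using nn_integral_eq_integral_bounded[OF P _ bounds] nn_integral_eq_integral_bounded[OF Q_prob[OF k] _ bounds] b0
    by (simp add: M.emeasure_eq_measure ennreal_mult')
  then have "(\<integral>\<omega>. f \<omega> + b \<partial>P) \<le> (\<integral>\<omega>. f \<omega> + b \<partial>Q k) + \<eta> + 2 * b * measure M (- G k)"
    using \<eta> b0 bounds by (simp add: ennreal_plus[symmetric] integral_nonneg ennreal_le_iff del: ennreal_plus)
  moreover have "(\<integral>\<omega>. f \<omega> + b \<partial>N) = (\<integral>\<omega>. f \<omega> \<partial>N) + b" if N: "N \<in> space (prob_algebra borel)" for N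
  proof -
    interpret N: prob_space N using N by (simp add: space_prob_algebra)
    have [measurable_cong]: "sets N = sets borel" using N by (simp add: space_prob_algebra)
    have "integrable N f" by (rule N.integrable_const_bound[of _ b]) (use b in auto)
    then show ?thesis by (simp add: N.prob_space)
  qed
  ultimately show ?thesis using P Q_prob[OF k] by simp
qed

section \<open>The limsup inequality and the Gamma-limit\<close>

context kernel_LDP
begin

text \<open>Inside any neighbourhood of a \<open>P\<close> of finite cost, the recovery measures are
  eventually admissible competitors with cost at most the limit cost plus e. Half of the radius
  \<delta> covers the oscillation on cells, the other half the exceptional initial points.\<close>

lemma Gamma_limsup:
  assumes P: "P \<in> space (prob_algebra borel)"
  shows "(SUP V\<in>nbhds_in narrow_topology P. limsup (\<lambda>k. INF Q\<in>V. cost k Q)) \<le> limit_cost P"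
proof (cases "distr P borel X = M \<and> (\<integral>\<^sup>+\<omega>. C \<omega> \<partial>P) < \<infinity>")
  case False
  then have "limit_cost P = \<infinity>" by (auto simp: limit_cost_def iota_def less_top[symmetric])
  then show ?thesis by simp
next
  case True
  show ?thesis
  proof (rule SUP_least)
    fix V assume "V \<in> nbhds_in narrow_topology P"
    then obtain U where U: "openin narrow_topology U" "P \<in> U" "U \<subseteq> V" by (auto simp: nbhds_in_def)
    from narrow_topology_base[OF U(1,2)] obtain F :: "('w \<Rightarrow> real) set" and \<delta>
      where F: "finite F" "0 < \<delta>" "\<forall>f\<in>F. continuous_on UNIV f \<and> bounded (range f)"
        and FU: "\<forall>Q\<in>space (prob_algebra borel). (\<forall>f\<in>F. \<bar>(\<integral>x. f x \<partial>Q) - (\<integral>x. f x \<partial>P)\<bar> < \<delta>) \<longrightarrow> Q \<in> U"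
      by (elim exE conjE)
    have "bounded (\<Union>f\<in>F. range f)" using F by (intro bounded_UN) auto
    then obtain b where b: "0 < b" "\<And>f \<omega>. f \<in> F \<Longrightarrow> \<bar>f \<omega>\<bar> \<le> b"
      unfolding bounded_pos by auto
    have "0 < \<delta> / 2" using F(2) by simp
    from exists_open_partition[OF P this F(1) F(3)] obtain \<A>
      where part: "finite \<A>" "disjoint \<A>" "\<forall>A\<in>\<A>. open A" "AE \<omega> in P. \<omega> \<in> \<Union>\<A>"
        "\<forall>f\<in>F. \<forall>A\<in>\<A>. \<forall>\<omega>\<in>A. \<forall>\<omega>'\<in>A. \<bar>f \<omega> - f \<omega>'\<bar> \<le> \<delta> / 2"
      by (elim exE conjE)
    show "limsup (\<lambda>k. INF Q\<in>V. cost k Q) \<le> limit_cost P"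
    proof (rule ereal_le_epsilon2)
      fix e :: real assume e: "0 < e"
      interpret recovery X C R M P \<A> e
        by unfold_locales (use P True part e in auto)
      \<comment> \<open>Multiplied by 2 b, this threshold is \<delta> / 4, below the \<delta> / 2
        still available.\<close>
      have "\<forall>\<^sub>F k in sequentially. emeasure M (- G k) < ennreal (\<delta> / (8 * b))"
        by (rule order_tendstoD(2)[OF emeasure_G_tendsto]) (use b F in simp)
      then have "\<forall>\<^sub>F k in sequentially. (INF Q\<in>V. cost k Q) \<le> limit_cost P + ereal e"
        using eventually_ge_at_top[of 1]
      proof eventually_elim
        case (elim k)
        then have k: "k \<ge> 1" by simp
        have "measure M (- G k) < \<delta> / (8 * b)"
          using elim b F(2) by (simp add: M.emeasure_eq_measure ennreal_less_iff)
        then have small: "2 * b * measure M (- G k) < \<delta> / 2" using b(1) F(2) by (simp add: field_simps)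
        have "Q k \<in> U"
        proof (rule FU[rule_format, OF Q_prob[OF k]])
          fix f assume f: "f \<in> F"
          have [measurable]: "f \<in> borel_measurable borel"
            using F(3) f by (intro borel_measurable_continuous_onI) simp
          have "(\<integral>\<omega>. f \<omega> \<partial>P) \<le> (\<integral>\<omega>. f \<omega> \<partial>Q k) + \<delta> / 2 + 2 * b * measure M (- G k)"
            by (rule integral_Q_ge[OF k]) (use b(2)[OF f] part(5)[rule_format, OF f] F(2) in auto)
          moreover have "(\<integral>\<omega>. - f \<omega> \<partial>P) \<le> (\<integral>\<omega>. - f \<omega> \<partial>Q k) + \<delta> / 2 + 2 * b * measure M (- G k)"
            by (rule integral_Q_ge[OF k]) (use b(2)[OF f] part(5)[rule_format, OF f] F(2) in \<open>auto simp: abs_minus_commute\<close>)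
          ultimately show "\<bar>(\<integral>\<omega>. f \<omega> \<partial>Q k) - (\<integral>\<omega>. f \<omega> \<partial>P)\<bar> < \<delta>" using small by auto
        qed
        then have "(INF Q\<in>V. cost k Q) \<le> cost k (Q k)" using U(3) by (intro INF_lower) auto
        also have "\<dots> = ereal (1 / real k) * rel_entropy (Q k) (mix k)"
          by (simp add: cost_def iota_def distr_Q[OF k])
        also have "\<dots> \<le> ereal (1 / real k) * enn2ereal (of_nat k * ((\<integral>\<^sup>+\<omega>. C \<omega> \<partial>P) + ennreal e))"
          by (rule ereal_mult_left_mono[OF rel_entropy_Q[OF k]]) simp
        also have "\<dots> = enn2ereal (\<integral>\<^sup>+\<omega>. C \<omega> \<partial>P) + ereal e"
          using finite_cost k e
          by (cases "\<integral>\<^sup>+\<omega>. C \<omega> \<partial>P")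
            (auto simp: ennreal_of_nat_eq_real_of_nat ennreal_mult'[symmetric] ennreal_plus[symmetric]
              enn2ereal_ennreal simp del: ennreal_plus)
        also have "\<dots> = limit_cost P + ereal e" using True by (simp add: limit_cost_def iota_def)
        finally show ?case .
      qed
      then show "limsup (\<lambda>k. INF Q\<in>V. cost k Q) \<le> limit_cost P + ereal e" by (rule Limsup_bounded)
    qed
  qed
qed

text \<open>Since liminf is at most limsup, the two inequalities close a chain of
  equalities.\<close>

lemma Gamma_lim_cost: "Gamma_lim narrow_topology cost limit_cost"
  unfolding Gamma_lim_def topspace_narrow_topology
proof (intro ballI conjI)
  fix P :: "'w measure" assume P: "P \<in> space (prob_algebra borel)"
  have "(SUP V\<in>nbhds_in narrow_topology P. liminf (\<lambda>k. INF Q\<in>V. cost k Q))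
      \<le> (SUP V\<in>nbhds_in narrow_topology P. limsup (\<lambda>k. INF Q\<in>V. cost k Q))"
    by (intro SUP_mono' Liminf_le_Limsup) simp
  then show "(SUP V\<in>nbhds_in narrow_topology P. liminf (\<lambda>k. INF Q\<in>V. cost k Q)) = limit_cost P"
    "(SUP V\<in>nbhds_in narrow_topology P. limsup (\<lambda>k. INF Q\<in>V. cost k Q)) = limit_cost P"
    using Gamma_liminf[OF P] Gamma_limsup[OF P] by auto
qed

end

theorem proposition3p4:
  fixes C :: "'a::polish_space cadlag \<Rightarrow> ennreal"
    and R :: "nat \<Rightarrow> 'a \<Rightarrow> 'a cadlag measure"
    and \<mu>\<^sub>0 :: "'a measure"
  assumes "lsc C"
    and "\<And>k. k \<ge> 1 \<Longrightarrow> R k \<in> borel \<rightarrow>\<^sub>M prob_algebra borel"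
    and "\<And>k x. k \<ge> 1 \<Longrightarrow> emeasure (R k x) {\<omega>. coord 0 \<omega> = x} = 1"
    and "\<And>x. LDP (\<lambda>k. R k x) (\<lambda>\<omega>. C \<omega> + iota {\<omega>. coord 0 \<omega> = x} \<omega>)"
    and "\<And>x. coercive (\<lambda>\<omega>. C \<omega> + iota {\<omega>. coord 0 \<omega> = x} \<omega>)"
    and "\<mu>\<^sub>0 \<in> space (prob_algebra borel)"
  shows "Gamma_lim narrow_topology
           (\<lambda>k P. ereal (1 / real k) * rel_entropy P (\<mu>\<^sub>0 \<bind> R k)
                  + iota {P. distr P borel (coord 0) = \<mu>\<^sub>0} P)
           (\<lambda>P. enn2ereal (\<integral>\<^sup>+ \<omega>. C \<omega> \<partial>P) + iota {P. distr P borel (coord 0) = \<mu>\<^sub>0} P)"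
proof -
  \<comment> \<open>Time changes fix 0, so the initial position is 1-Lipschitz for the Skorokhod
    metric and may serve as \<open>X\<close>.\<close>
  interpret kernel_LDP "coord 0" C R \<mu>\<^sub>0
    by unfold_locales (use assms continuous_coord_0 in auto)
  show ?thesis
    using Gamma_lim_cost unfolding cost_def[abs_def] limit_cost_def[abs_def] mix_def .
qed

end
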